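(* Let $\{X_t\}_{t\in\mathbb Z}$ be an SFIEGARCH$(p,d,q)_s$ process with $d<0.5$. Suppose that $\gamma$ and $\theta$ are not both equal to zero and that $\alpha(z)\ne0$ in the closed disk $\{z:|z|\le1\}$. If $\sigma^2_{\ln(Z_t^2)}:=\mathrm{Var}(\ln(Z_t^2))<\infty$ for all $t\in\mathbb Z$, then the spectral density function of $\{\ln(X_t^2)\}_{t\in\mathbb Z}$ is given by $$f_{\ln(X_t^2)}(\lambda)=f_{\ln(\sigma_t^2)}(\lambda)+\frac{C_1}{\pi}\Re\big(e^{-\mathrm i\lambda}\Lambda(\lambda)\big)+f_{\ln(Z_t^2)}(\lambda),\qquad\lambda\in[0,\pi],$$ where $$f_{\ln(\sigma_t^2)}(\lambda)=\frac{\sigma_g^2}{2\pi}\frac{|\alpha(e^{-\mathrm i\lambda})|^2}{|\beta(e^{-\mathrm i\lambda})|^2}\,|1-e^{-\mathrm is\lambda}|^{-2d},$$ $f_{\ln(Z_t^2)}(\lambda)=\frac{\sigma^2_{\ln(Z_t^2)}}{2\pi}$ is the spectral density function of $\{\ln(Z_t^2)\}_{t\in\mathbb Z}$, $C_1=\mathrm{Cov}(g(Z_0),\ln(Z_0^2))$, and $\Lambda(z):=\frac{\alpha(e^{-\mathrm iz})}{\beta(e^{-\mathrm iz})}(1-e^{-\mathrm isz})^{-d}$.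
   Context: An SFIEGARCH$(p,d,q)_s$ process is a process $\{X_t\}_{t\in\mathbb Z}$ defined by $X_t=\sigma_tZ_t$ and $\ln(\sigma_t^2)=\omega+\sum_{k=0}^\infty\lambda_{d,k}g(Z_{t-1-k})$ for all $t\in\mathbb Z$, where: $\{Z_t\}_{t\in\mathbb Z}$ is i.i.d. with zero mean and variance one; $g(Z_t)=\theta Z_t+\gamma[|Z_t|-\mathbb E(|Z_t|)]$ with $\theta,\gamma\in\mathbb R$; $\omega,d\in\mathbb R$; $s\ge1$ is an integer; $\alpha(z)=\sum_{i=0}^p(-\alpha_i)z^i$ and $\beta(z)=\sum_{j=0}^q(-\beta_j)z^j$ are real polynomials of orders $p,q$ with $\alpha_0=\beta_0=-1$, without common roots, and $\beta(z)\neq0$ for $|z|\le1$; and $\frac{\alpha(z)}{\beta(z)}(1-z^s)^{-d}=\sum_{k=0}^\infty\lambda_{d,k}z^k$, $|z|<1$. $\sigma_g^2=\mathrm{Var}(g(Z_0))$; $\mathrm i$ is the imaginary unit and $\Re$ the real part. The spectral density $f$ of a weakly stationary real process with autocovariance function $\gamma(\cdot)$ is normalized by $\gamma(h)=\int_{(-\pi,\pi]}e^{\mathrm ih\lambda}f(\lambda)\,d\lambda$ for $h\in\mathbb Z$, with $f$ even. *)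

theory Defs
  imports "HOL-Probability.Probability" "HOL-Computational_Algebra.Polynomial"
begin

section \<open>Second-order notions for real processes\<close>

definition cov :: "'a measure \<Rightarrow> ('a \<Rightarrow> real) \<Rightarrow> ('a \<Rightarrow> real) \<Rightarrow> real" where
  "cov M U V = (\<integral>x. (U x - (\<integral>y. U y \<partial>M)) * (V x - (\<integral>y. V y \<partial>M)) \<partial>M)"

definition finite_variance :: "'a measure \<Rightarrow> ('a \<Rightarrow> real) \<Rightarrow> bool" where
  "finite_variance M U \<longleftrightarrow> integrable M U \<and> integrable M (\<lambda>x. (U x)\<^sup>2)"

text \<open>Mathematically, \<open>ln 0 = -\<infinity>\<close>, so a finite variance of \<open>ln W\<close> forces \<open>W > 0\<close> almost surely.
  This has to be said explicitly because in HOL \<open>ln 0 = 0\<close>.\<close>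

definition finite_variance_ln :: "'a measure \<Rightarrow> ('a \<Rightarrow> real) \<Rightarrow> bool" where
  "finite_variance_ln M W \<longleftrightarrow> (AE x in M. W x > 0) \<and> finite_variance M (\<lambda>x. ln (W x))"

definition weakly_stationary :: "'a measure \<Rightarrow> (int \<Rightarrow> 'a \<Rightarrow> real) \<Rightarrow> bool" where
  "weakly_stationary M Y \<longleftrightarrow>
     (\<forall>t. finite_variance M (Y t)) \<and>
     (\<forall>t. (\<integral>x. Y t x \<partial>M) = (\<integral>x. Y 0 x \<partial>M)) \<and>
     (\<forall>t h. cov M (Y (t + h)) (Y t) = cov M (Y h) (Y 0))"

definition autocov :: "'a measure \<Rightarrow> (int \<Rightarrow> 'a \<Rightarrow> real) \<Rightarrow> int \<Rightarrow> real" where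
  "autocov M Y h = cov M (Y h) (Y 0)"

text \<open>Spectral densities are only determined up to null sets; the predicate says that \<open>f\<close> is a
  version of the spectral density of the weakly stationary process \<open>Y\<close>.\<close>

definition has_spectral_density ::
    "'a measure \<Rightarrow> (int \<Rightarrow> 'a \<Rightarrow> real) \<Rightarrow> (real \<Rightarrow> real) \<Rightarrow> bool" where
  "has_spectral_density M Y f \<longleftrightarrow>
     weakly_stationary M Y \<and>
     set_integrable lborel {-pi<..pi} f \<and>
     (\<forall>l\<in>{-pi<..pi}. f l \<ge> 0) \<and>
     (\<forall>l\<in>{-pi<..<pi}. f (- l) = f l) \<and>
     (\<forall>h. complex_of_real (autocov M Y h) =
            (LINT l:{-pi<..pi}|lborel. exp (\<i> * of_int h * of_real l) * of_real (f l)))"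

section \<open>SFIEGARCH processes\<close>

text \<open>Powers with the convention \<open>0\<^sup>0 = 1\<close> (HOL has \<open>0 powr a = 0\<close> for every \<open>a\<close>). With this,
  \<open>0\<^sup>a\<close> has its usual value for real \<open>a \<ge> 0\<close>; for \<open>a < 0\<close> it is the dummy value \<open>0\<close>.
  Complex powers use the principal branch.\<close>

definition gpow :: "'a::{ln,real_normed_field} \<Rightarrow> 'a \<Rightarrow> 'a" where
  "gpow w a = (if a = 0 then 1 else w powr a)"

abbreviation cpoly :: "real poly \<Rightarrow> complex \<Rightarrow> complex" where
  "cpoly P z \<equiv> poly (map_poly complex_of_real P) z"

text \<open>The filter \<open>\<alpha>(z) / \<beta>(z) (1 - z\<^sup>s)\<^bsup>-d\<^esup>\<close>, and its boundary values \<open>\<Lambda>\<close>.\<close>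

definition sfie_filter :: "real poly \<Rightarrow> real poly \<Rightarrow> nat \<Rightarrow> real \<Rightarrow> complex \<Rightarrow> complex" where
  "sfie_filter \<alpha> \<beta> s d z = cpoly \<alpha> z / cpoly \<beta> z * gpow (1 - z ^ s) (of_real (- d))"

definition Lambda :: "real poly \<Rightarrow> real poly \<Rightarrow> nat \<Rightarrow> real \<Rightarrow> real \<Rightarrow> complex" where
  "Lambda \<alpha> \<beta> s d l = sfie_filter \<alpha> \<beta> s d (exp (- \<i> * of_real l))"

definition gfun :: "'a measure \<Rightarrow> real \<Rightarrow> real \<Rightarrow> ('a \<Rightarrow> real) \<Rightarrow> 'a \<Rightarrow> real" where
  "gfun M \<theta> \<gamma> U x = \<theta> * U x + \<gamma> * (\<bar>U x\<bar> - (\<integral>y. \<bar>U y\<bar> \<partial>M))"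

text \<open>The polynomials \<open>\<alpha>(z) = \<Sum>i\<le>p. (-\<alpha>\<^sub>i) z\<^sup>i\<close> and \<open>\<beta>(z) = \<Sum>j\<le>q. (-\<beta>\<^sub>j) z\<^sup>j\<close> have constant
  coefficient \<open>1\<close> because \<open>\<alpha>\<^sub>0 = \<beta>\<^sub>0 = -1\<close>. The defining equations of the process hold almost surely,
  the series being an almost sure limit of partial sums. The condition \<open>\<sigma> t x \<noteq> 0\<close> is
  implicit in \<open>ln (\<sigma>\<^sub>t\<^sup>2)\<close> being a real number, but not in HOL where \<open>ln 0 = 0\<close>.\<close>

locale sfiegarch = prob_space M
  for M :: "'a measure"
    and p :: nat and d :: real and q :: nat and s :: nat
    and \<alpha> \<beta> :: "real poly" and \<theta> \<gamma> \<omega> :: real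
    and lam :: "nat \<Rightarrow> real"
    and Z \<sigma> X :: "int \<Rightarrow> 'a \<Rightarrow> real" +
  assumes s_pos: "s \<ge> 1"
    and degree_alpha: "degree \<alpha> = p" and alpha_0: "coeff \<alpha> 0 = 1"
    and degree_beta: "degree \<beta> = q" and beta_0: "coeff \<beta> 0 = 1"
    and no_common_root: "\<not> (\<exists>z. cpoly \<alpha> z = 0 \<and> cpoly \<beta> z = 0)"
    and beta_nonzero: "\<And>z. norm z \<le> 1 \<Longrightarrow> cpoly \<beta> z \<noteq> 0"
    and lam_series: "\<And>z. norm z < 1 \<Longrightarrow>
          (\<lambda>k. complex_of_real (lam k) * z ^ k) sums sfie_filter \<alpha> \<beta> s d z"
    and Z_indep: "indep_vars (\<lambda>_. borel) Z UNIV"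
    and Z_ident: "\<And>t. distr M borel (Z t) = distr M borel (Z 0)"
    and Z_finite_variance: "\<And>t. finite_variance M (Z t)"
    and Z_mean: "\<And>t. expectation (Z t) = 0"
    and Z_variance: "\<And>t. variance (Z t) = 1"
    and sigma_rv: "\<And>t. random_variable borel (\<sigma> t)"
    and X_rv: "\<And>t. random_variable borel (X t)"
    and X_eq: "\<And>t. AE x in M. X t x = \<sigma> t x * Z t x"
    and sigma_eq: "\<And>t. AE x in M. \<sigma> t x \<noteq> 0 \<and>
          (\<lambda>k. lam k * gfun M \<theta> \<gamma> (Z (t - 1 - int k)) x) sums (ln ((\<sigma> t x)\<^sup>2) - \<omega>)"

end

theory Submission
  imports Defs
begin

text \<open>
  Centred at its mean, \<open>ln (\<sigma>\<^sub>t\<^sup>2)\<close> is the causal moving average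
  \<open>V\<^sub>t = \<Sum>k. \<lambda>\<^sub>k g(Z\<^bsub>t-1-k\<^esub>)\<close> of the white noise \<open>g(Z\<^sub>t)\<close>, and
  \<open>ln (X\<^sub>t\<^sup>2) = ln (\<sigma>\<^sub>t\<^sup>2) + ln (Z\<^sub>t\<^sup>2)\<close>. Put \<open>\<lambda>\<^sub>m = 0\<close> for \<open>m < 0\<close>. Since \<open>g(Z\<^sub>t)\<close> and
  \<open>ln (Z\<^sub>u\<^sup>2)\<close> are correlated only for \<open>t = u\<close>, bilinearity gives the autocovariance at lag \<open>h\<close> as
  \<open>\<sigma>\<^sub>g\<^sup>2 \<Sum>k. \<lambda>\<^sub>k \<lambda>\<^bsub>k-h\<^esub> + C\<^sub>1 (\<lambda>\<^bsub>h-1\<^esub> + \<lambda>\<^bsub>-h-1\<^esub>) + Var(ln (Z\<^sub>0\<^sup>2)) [h = 0]\<close>.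
  The three terms are the Fourier coefficients of the three summands of the density, once \<open>\<lambda>\<close> is known
  to be the square summable sequence of Fourier coefficients of the boundary function \<open>\<Lambda>\<close>.

  That last point is where \<open>d < 1/2\<close> enters. The filter is a power series in the open disk, and its values
  on the circle of radius \<open>r < 1\<close> are, uniformly in \<open>r\<close>, at most a constant times
  \<open>1 + |1 - e\<^bsup>-isl\<^esup>|\<^bsup>-d\<^esup>\<close>, which is square integrable on the circle because
  \<open>2 d < 1\<close>. On each such circle the Fourier identities hold by absolute convergence; letting \<open>r\<close> tend
  to 1 by dominated convergence yields square summability of \<open>\<lambda>\<close> and the identities for \<open>\<Lambda>\<close>
  (locale \<open>hardy_boundary\<close>, with the hypotheses supplied by \<open>sfie_hardy_boundary\<close>).

  Square summability in turn makes the partial sums of the almost surely convergent series \<open>V\<^sub>t\<close> a Cauchy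
  sequence in mean square. By Fatou's lemma the almost sure limit is also the mean square limit, so that
  expectations of products with \<open>V\<^sub>t\<close> may be computed term by term (\<open>orthogonal_series\<close>).

  The proposed density of \<open>ln (X\<^sub>t\<^sup>2)\<close> is nonnegative at every frequency, because \<open>2\<pi>\<close> times it is at
  least the variance of \<open>x g(Z\<^sub>0) + ln (Z\<^sub>0\<^sup>2)\<close> for the real number \<open>x = Re (e\<^bsup>-il\<^esup> \<Lambda>(l))\<close>.
\<close>

section \<open>Fourier coefficients on the circle\<close>

definition circle_measure :: "real measure" where
  "circle_measure = restrict_space lborel {-pi<..pi}"

lemma finite_measure_circle: "finite_measure circle_measure"
  unfolding circle_measure_def
  by (rule finite_measureI) (simp add: space_restrict_space emeasure_restrict_space)

interpretation circle: finite_measure circle_measure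
  by (rule finite_measure_circle)

lemma borel_measurable_circle: 
  "f \<in> borel_measurable borel \<Longrightarrow> f \<in> borel_measurable circle_measure"
  unfolding circle_measure_def by (simp add: measurable_restrict_space1)

lemma integrable_circle_iff:
  fixes f :: "real \<Rightarrow> 'b::{banach, second_countable_topology}"
  shows "integrable circle_measure f \<longleftrightarrow> set_integrable lborel {-pi<..pi} f"
  unfolding circle_measure_def set_integrable_def by (simp add: integrable_restrict_space)

lemma integral_circle_eq:
  fixes f :: "real \<Rightarrow> 'b::{banach, second_countable_topology}"
  shows "integral\<^sup>L circle_measure f = (LINT l:{-pi<..pi}|lborel. f l)"
  unfolding circle_measure_def set_lebesgue_integral_def by (simp add: integral_restrict_space)

lemma AE_circleI: "AE l in lborel. P l \<Longrightarrow> AE l in circle_measure. P l"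
  unfolding circle_measure_def by (auto simp: AE_restrict_space_iff elim: eventually_mono)

lemma measurable_cis [measurable]: "(\<lambda>l. cis (c * l)) \<in> borel_measurable circle_measure"
  by (intro borel_measurable_circle borel_measurable_continuous_onI continuous_intros)

lemma integrable_cis: "integrable circle_measure (\<lambda>l. cis (c * l))"
  by (rule circle.integrable_const_bound[where B=1]) auto

lemma integral_cis:
  "(LINT l|circle_measure. cis (of_int n * l)) = (if n = 0 then 2 * pi else 0)"
proof -
  have "(LINT l|circle_measure. cis (of_int n * l))
      = (\<integral>l. indicator {-pi..pi} l *\<^sub>R cis (of_int n * l) \<partial>lborel)"
    unfolding integral_circle_eq set_lebesgue_integral_def
  proof (rule integral_cong_AE)
    show "AE l in lborel. indicator {-pi<..pi} l *\<^sub>R cis (of_int n * l) = indicator {-pi..pi} l *\<^sub>R cis (of_int n * l)"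
      using AE_lborel_singleton[of "-pi"] by eventually_elim (auto simp: indicator_def)
    have [measurable]: "(\<lambda>l. cis (real_of_int n * l)) \<in> borel_measurable borel"
      by (intro borel_measurable_continuous_onI continuous_intros)
    show "(\<lambda>l. indicator {-pi<..pi} l *\<^sub>R cis (real_of_int n * l)) \<in> borel_measurable lborel"
      "(\<lambda>l. indicator {-pi..pi} l *\<^sub>R cis (real_of_int n * l)) \<in> borel_measurable lborel"
      by measurable
  qed
  also have "\<dots> = (if n = 0 then 2 * pi else 0)"
  proof (cases "n = 0")
    case True
    then show ?thesis
      using pi_gt_zero by (simp add: scaleR_conv_of_real)
  next
    case False
    let ?F = "\<lambda>l. cis (of_int n * l) / (\<i> * of_int n)"
    have "(\<integral>l. indicator {-pi..pi} l *\<^sub>R cis (of_int n * l) \<partial>lborel) = ?F pi - ?F (- pi)"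
    proof (rule integral_FTC_atLeastAtMost)
      fix l :: real
      let ?G = "\<lambda>z. exp (\<i> * of_int n * z) / (\<i> * of_int n)"
      have "(?G has_field_derivative exp (\<i> * of_int n * of_real l)) (at (of_real l))"
        using False by (auto intro!: derivative_eq_intros)
      from has_vector_derivative_real_field[OF this, of "{-pi..pi}"]
      show "(?F has_vector_derivative cis (real_of_int n * l)) (at l within {-pi..pi})"
        by (simp add: cis_conv_exp mult.assoc)
    qed (auto intro!: continuous_intros)
    also have "cis (of_int n * pi) = cis (of_int n * (- pi))"
      by (simp add: complex_eq_iff sin_times_pi_eq_0)
    finally show ?thesis using False by simp
  qed
  finally show ?thesis .
qed

text \<open>Because the coefficients are absolutely summable and \<open>|e\<^bsup>-ikl\<^esup>| = 1\<close>, sum and integral may be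
  exchanged against any integrable weight \<open>G\<close>. Taking for \<open>G\<close> a character, or a character times the
  conjugate of the series itself, produces the Fourier coefficients of the series and of its squared modulus.\<close>

lemma circle_integral_series:
  fixes c :: "nat \<Rightarrow> complex" and G :: "real \<Rightarrow> complex"
  assumes c: "summable (\<lambda>k. norm (c k))" and G: "integrable circle_measure G"
  shows "integrable circle_measure (\<lambda>l. (\<Sum>k. c k * cis (- (real k * l))) * G l)"
    and "(\<lambda>k. c k * (LINT l|circle_measure. cis (- (real k * l)) * G l))
           sums (LINT l|circle_measure. (\<Sum>k. c k * cis (- (real k * l))) * G l)"
proof -
  let ?f = "\<lambda>k l. c k * (cis (- (real k * l)) * G l)"
  have cisG: "integrable circle_measure (\<lambda>l. cis (- (real k * l)) * G l)" for k
  proof (rule Bochner_Integration.integrable_bound[OF G])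
    have [measurable]: "(\<lambda>l. cis (- (real k * l))) \<in> borel_measurable circle_measure"
      using measurable_cis[of "- real k"] by simp
    show "(\<lambda>l. cis (- (real k * l)) * G l) \<in> borel_measurable circle_measure"
      using G by measurable
  qed (simp add: norm_mult)
  have 1: "integrable circle_measure (?f k)" for k
    using cisG by (intro integrable_mult_right)
  have n: "norm (?f k l) = norm (c k) * norm (G l)" for k l
    by (simp add: norm_mult)
  have 2: "AE l in circle_measure. summable (\<lambda>k. norm (?f k l))"
    unfolding n using c by (auto intro: summable_mult2)
  have 3: "summable (\<lambda>k. LINT l|circle_measure. norm (?f k l))"
    unfolding n using c by (auto intro: summable_mult2)
  have s: "(\<Sum>k. ?f k l) = (\<Sum>k. c k * cis (- (real k * l))) * G l" for l
    using suminf_mult2[of "\<lambda>k. c k * cis (- (real k * l))" "G l"] summable_norm_cancel[of "\<lambda>k. c k * cis (- (real k * l))"] c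
    by (simp add: norm_mult mult.assoc)
  show "integrable circle_measure (\<lambda>l. (\<Sum>k. c k * cis (- (real k * l))) * G l)"
    using integrable_suminf[OF 1 2 3] by (simp add: s)
  show "(\<lambda>k. c k * (LINT l|circle_measure. cis (- (real k * l)) * G l))
           sums (LINT l|circle_measure. (\<Sum>k. c k * cis (- (real k * l))) * G l)"
    using sums_integral[OF 1 2 3] by (simp add: s)
qed

text \<open>Extending the coefficients by zero to negative indices lets one formula cover all lags: a causal filter
  has no response to future noise, and its boundary function has no Fourier coefficients of negative index.\<close>

definition zero_ext :: "(nat \<Rightarrow> real) \<Rightarrow> int \<Rightarrow> real" where
  "zero_ext a m = (if m \<ge> 0 then a (nat m) else 0)"

lemma summable_zero_ext_shift:
  assumes "summable (\<lambda>k. (a k)\<^sup>2)"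
  shows "summable (\<lambda>k. (zero_ext a (int k - h))\<^sup>2)"
proof (cases "h \<ge> 0")
  case True
  have "(\<lambda>k. (zero_ext a (int (k + nat h) - h))\<^sup>2) = (\<lambda>k. (a k)\<^sup>2)"
    using True by (auto simp: zero_ext_def)
  then show ?thesis
    using assms summable_iff_shift[of "\<lambda>k. (zero_ext a (int k - h))\<^sup>2" "nat h"] by simp
next
  case False
  have "nat (int k - h) = k + nat (- h)" for k
    using False by linarith
  with False have "(\<lambda>k. (zero_ext a (int k - h))\<^sup>2) = (\<lambda>k. (a (k + nat (- h)))\<^sup>2)"
    by (auto simp: zero_ext_def)
  then show ?thesis
    using assms summable_iff_shift[of "\<lambda>k. (a k)\<^sup>2" "nat (- h)"] by simp
qed

text \<open>A power series in the disk with a square integrable majorant \<open>D\<close> on all circles belongs to the Hardy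
  space \<open>H\<^sup>2\<close>, and \<open>B\<close> is its radial boundary function. The angle is \<open>-l\<close> because the transfer
  function of a linear filter is evaluated at \<open>e\<^bsup>-il\<^esup>\<close>. Requiring a majorant replaces the theory of
  maximal functions: it makes every passage to the boundary an instance of dominated convergence.\<close>

locale hardy_boundary =
  fixes a :: "nat \<Rightarrow> real" and F :: "complex \<Rightarrow> complex" and B :: "real \<Rightarrow> complex" and D :: "real \<Rightarrow> real"
  assumes series: "\<And>z. norm z < 1 \<Longrightarrow> (\<lambda>k. of_real (a k) * z ^ k) sums F z"
    and dominated: "AE l in circle_measure. \<forall>r. 0 \<le> r \<and> r < 1 \<longrightarrow> norm (F (of_real r * cis (- l))) \<le> D l"
    and radial_limit: "AE l in circle_measure. ((\<lambda>r. F (of_real r * cis (- l))) \<longlongrightarrow> B l) (at_left 1)"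
    and B_measurable [measurable]: "B \<in> borel_measurable circle_measure"
    and D_measurable [measurable]: "D \<in> borel_measurable circle_measure"
    and D_square_integrable: "integrable circle_measure (\<lambda>l. (D l)\<^sup>2)"
begin

lemma summable_on_radius:
  assumes "0 \<le> r" "r < 1"
  shows "summable (\<lambda>k. norm (complex_of_real (a k * r ^ k)))"
proof -
  obtain K where K: "r < K" "K < 1" using assms(2) dense by blast
  have "summable (\<lambda>k. complex_of_real (a k) * of_real K ^ k)"
    using K assms by (intro sums_summable[OF series]) auto
  then have "summable (\<lambda>k. norm (complex_of_real (a k) * of_real r ^ k))"
    using K assms by (intro powser_insidea[where x="of_real K"]) auto
  then show ?thesis by simp
qed

lemma F_on_radius:
  assumes "0 \<le> r" "r < 1"
  shows "F (of_real r * cis (- l)) = (\<Sum>k. complex_of_real (a k * r ^ k) * cis (- (real k * l)))"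
  using sums_unique[OF series[of "of_real r * cis (- l)"]] assms
  by (simp add: norm_mult power_mult_distrib Complex.DeMoivre mult_ac)

lemma integrable_F_mult:
  assumes "0 \<le> r" "r < 1" "integrable circle_measure G"
  shows "integrable circle_measure (\<lambda>l. F (of_real r * cis (- l)) * G l)"
  using circle_integral_series(1)[OF summable_on_radius assms(3), of r] assms F_on_radius by simp

text \<open>Orthogonality of the characters picks the single term \<open>k = h\<close> out of the series.\<close>

lemma integral_F_cis:
  assumes r: "0 \<le> r" "r < 1"
  shows "(LINT l|circle_measure. F (of_real r * cis (- l)) * cis (of_int h * l))
      = of_real (2 * pi * (zero_ext a h * r ^ nat h))"
proof -
  let ?c = "\<lambda>k. complex_of_real (a k * r ^ k)"
  have "(\<lambda>k. ?c k * (LINT l|circle_measure. cis (- (real k * l)) * cis (of_int h * l)))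
           sums (LINT l|circle_measure. F (of_real r * cis (- l)) * cis (of_int h * l))"
    using circle_integral_series(2)[OF summable_on_radius[OF r] integrable_cis[of "of_int h"]]
    by (simp add: F_on_radius r)
  moreover have "(LINT l|circle_measure. cis (- (real k * l)) * cis (of_int h * l)) = (if int k = h then 2 * pi else 0)" for k
    using integral_cis[of "h - int k"] by (simp add: cis_mult algebra_simps)
  moreover have "(\<lambda>k. ?c k * (if int k = h then 2 * pi else 0))
           sums (\<Sum>k\<in>(if h \<ge> 0 then {nat h} else {}). ?c k * (if int k = h then 2 * pi else 0))"
    by (rule sums_finite) (auto split: if_splits)
  ultimately have "(LINT l|circle_measure. F (of_real r * cis (- l)) * cis (of_int h * l))
      = (\<Sum>k\<in>(if h \<ge> 0 then {nat h} else {}). ?c k * (if int k = h then 2 * pi else 0))"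
    by (metis (no_types, lifting) sums_unique2 sums_cong)
  then show ?thesis
    by (simp add: zero_ext_def)
qed

text \<open>Only one of the two factors is expanded in its series; the remaining integrals are conjugates of
  Fourier coefficients of the other factor, which avoids a double series.\<close>

lemma integral_F_cnj_F_cis:
  assumes r: "0 \<le> r" "r < 1"
  shows "(\<lambda>k. complex_of_real (2 * pi * (a k * r ^ k * (zero_ext a (int k - h) * r ^ nat (int k - h)))))
       sums (LINT l|circle_measure. F (of_real r * cis (- l)) * (cnj (F (of_real r * cis (- l))) * cis (of_int h * l)))"
proof -
  let ?c = "\<lambda>k. complex_of_real (a k * r ^ k)"
  let ?F = "\<lambda>l. F (of_real r * cis (- l))"
  let ?G = "\<lambda>l. cnj (?F l) * cis (of_int h * l)"
  have Fc: "integrable circle_measure (\<lambda>l. ?F l * cis (of_int m * l))" for m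
    by (intro integrable_F_mult r integrable_cis)
  have Gc: "?G l = cnj (?F l * cis (of_int (- h) * l))" for l
    by (simp add: cis_cnj)
  have G: "integrable circle_measure ?G"
    unfolding Gc using Fc[of "-h"] by (subst complex_integrable_cnj)
  have "(\<lambda>k. ?c k * (LINT l|circle_measure. cis (- (real k * l)) * ?G l))
       sums (LINT l|circle_measure. ?F l * ?G l)"
    using circle_integral_series(2)[OF summable_on_radius[OF r] G] by (simp add: F_on_radius r)
  moreover have "(LINT l|circle_measure. cis (- (real k * l)) * ?G l)
        = of_real (2 * pi * (zero_ext a (int k - h) * r ^ nat (int k - h)))" for k
  proof -
    have "cis (- (real k * l)) * ?G l = cnj (?F l * cis (of_int (int k - h) * l))" for l
      by (simp add: cis_cnj cis_mult algebra_simps)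
    then have "(LINT l|circle_measure. cis (- (real k * l)) * ?G l)
        = (LINT l|circle_measure. cnj (?F l * cis (of_int (int k - h) * l)))" by metis
    also have "\<dots> = cnj (LINT l|circle_measure. (?F l * cis (of_int (int k - h) * l)))"
      by (rule Bochner_Integration.integral_cnj)
    finally show ?thesis
      by (subst (asm) integral_F_cis[OF r]) simp
  qed
  ultimately show ?thesis by (simp add: mult_ac)
qed

text \<open>Dominated convergence is stated for sequences, so the limit towards the boundary is taken along
  radii \<open>1 - 1/(n+1)\<close>.\<close>

definition radius :: "nat \<Rightarrow> real" where "radius n = 1 - inverse (real (Suc n))"

lemma radius: "0 \<le> radius n" "radius n < 1" 
  by (auto simp: radius_def field_simps)

lemma radius_tendsto: "radius \<longlonglongrightarrow> 1"
  unfolding radius_def using tendsto_diff[OF tendsto_const LIMSEQ_inverse_real_of_nat, of 1] by simp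

lemma radius_at_left: "filterlim radius (at_left 1) sequentially"
  unfolding filterlim_at using radius_tendsto radius by (auto simp: less_imp_neq)

lemma D_integrable: "integrable circle_measure (\<lambda>l. \<bar>D l\<bar>)"
  by (rule circle.square_integrable_imp_integrable[OF _ ]) (use D_square_integrable in auto)

lemma F_measurable: "(\<lambda>l. F (of_real (radius n) * cis (- l))) \<in> borel_measurable circle_measure"
  using integrable_F_mult[of "radius n" "\<lambda>_. 1"] radius by auto

lemma dominated_radius:
  "AE l in circle_measure. \<forall>n. norm (F (of_real (radius n) * cis (- l))) \<le> D l"
  using dominated by eventually_elim (blast intro: radius)

lemma limit_F:
  "AE l in circle_measure. (\<lambda>n. F (of_real (radius n) * cis (- l))) \<longlonglongrightarrow> B l"
  using radial_limit by eventually_elim (rule filterlim_compose[OF _ radius_at_left])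

text \<open>The limit of the identity \<open>integral_F_cis\<close>; on the right-hand side \<open>r ^ nat h\<close> tends to 1.\<close>

lemma integrable_B: "integrable circle_measure B"
  and fourier_coefficient_B:
    "(LINT l|circle_measure. B l * cis (of_int h * l)) = of_real (2 * pi * zero_ext a h)"
proof -
  note [measurable] = F_measurable
  have bd: "AE l in circle_measure. norm (F (of_real (radius n) * cis (- l)) * cis (of_int h * l)) \<le> \<bar>D l\<bar>" for n h
    using dominated_radius by eventually_elim (auto simp: norm_mult intro: order_trans)
  have lim: "AE l in circle_measure. (\<lambda>n. F (of_real (radius n) * cis (- l)) * cis (of_int h * l)) \<longlonglongrightarrow> B l * cis (of_int h * l)" for h
    using limit_F by eventually_elim (intro tendsto_intros)
  have m: "(\<lambda>l. B l * cis (of_int h * l)) \<in> borel_measurable circle_measure"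
     "(\<lambda>l. F (of_real (radius n) * cis (- l)) * cis (of_int h * l)) \<in> borel_measurable circle_measure" for h n
    subgoal by (intro borel_measurable_times B_measurable measurable_cis)
    subgoal by (intro borel_measurable_times F_measurable measurable_cis)
    done
  show "integrable circle_measure B"
    using integrable_dominated_convergence[OF m D_integrable lim bd, of 0] by simp
  have 1: "(\<lambda>n. of_real (2 * pi * (zero_ext a h * radius n ^ nat h))) \<longlonglongrightarrow> (LINT l|circle_measure. B l * cis (of_int h * l))"
    using integral_dominated_convergence[OF m D_integrable lim bd, of h] by (simp add: integral_F_cis radius)
  have 2: "(\<lambda>n. complex_of_real (2 * pi * (zero_ext a h * radius n ^ nat h))) \<longlonglongrightarrow> of_real (2 * pi * (zero_ext a h * 1 ^ nat h))"
    by (intro tendsto_intros radius_tendsto)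
  show "(LINT l|circle_measure. B l * cis (of_int h * l)) = of_real (2 * pi * zero_ext a h)"
    using LIMSEQ_unique[OF 1 2] by simp
qed

lemma integrable_norm_B_square: "integrable circle_measure (\<lambda>l. (norm (B l))\<^sup>2)"
  and integral_F_norm_B_limit:
    "(\<lambda>n. LINT l|circle_measure. F (of_real (radius n) * cis (- l)) * (cnj (F (of_real (radius n) * cis (- l))) * cis (of_int h * l)))
      \<longlonglongrightarrow> (LINT l|circle_measure. of_real ((norm (B l))\<^sup>2) * cis (of_int h * l))"
proof -
  note [measurable] = F_measurable
  let ?f = "\<lambda>n h l. F (of_real (radius n) * cis (- l)) * (cnj (F (of_real (radius n) * cis (- l))) * cis (of_int h * l))"
  have bd: "AE l in circle_measure. norm (?f n h l) \<le> (D l)\<^sup>2" for n h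
    using dominated_radius
    by eventually_elim (simp add: norm_mult power_mono flip: power2_eq_square)
  have lim: "AE l in circle_measure. (\<lambda>n. ?f n h l) \<longlonglongrightarrow> of_real ((norm (B l))\<^sup>2) * cis (of_int h * l)" for h
    using limit_F
  proof eventually_elim
    case (elim l)
    then have "(\<lambda>n. ?f n h l) \<longlonglongrightarrow> B l * (cnj (B l) * cis (of_int h * l))"
      by (intro tendsto_intros)
    then show ?case by (simp only: complex_norm_square mult.assoc)
  qed
  have m: "(\<lambda>l. complex_of_real ((norm (B l))\<^sup>2) * cis (of_int h * l)) \<in> borel_measurable circle_measure"
     "?f n h \<in> borel_measurable circle_measure" for h n
    subgoal by measurable
    subgoal by (intro borel_measurable_times F_measurable measurable_cis
          measurable_compose[OF F_measurable borel_measurable_continuous_onI[where f=cnj]] continuous_intros)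
    done
  have "integrable circle_measure (\<lambda>l. complex_of_real ((norm (B l))\<^sup>2))"
    using integrable_dominated_convergence[OF m D_square_integrable lim bd, of 0] by simp
  then show "integrable circle_measure (\<lambda>l. (norm (B l))\<^sup>2)"
    using complex_of_real_integrable_eq by blast
  show "(\<lambda>n. LINT l|circle_measure. ?f n h l) \<longlonglongrightarrow> (LINT l|circle_measure. of_real ((norm (B l))\<^sup>2) * cis (of_int h * l))"
    by (rule integral_dominated_convergence[OF m D_square_integrable lim bd])
qed

text \<open>Lag 0 is Parseval's identity on the circle of radius \<open>r\<close>. It bounds every partial sum of
  \<open>(a k * r ^ k)\<^sup>2\<close> by \<open>1 / (2 pi)\<close> times the integral of \<open>D\<^sup>2\<close>, a bound free of \<open>r\<close>.\<close>

lemma summable_coefficients_square: "summable (\<lambda>k. (a k)\<^sup>2)"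
proof (rule summableI_nonneg_bounded)
  let ?I = "LINT l|circle_measure. (D l)\<^sup>2"
  fix K
  have "(\<Sum>k<K. 2 * pi * (a k * radius n ^ k)\<^sup>2) \<le> ?I" for n
  proof -
    let ?F = "\<lambda>l. F (of_real (radius n) * cis (- l))"
    have "?F l * (cnj (?F l) * cis (of_int 0 * l)) = of_real ((norm (?F l))\<^sup>2)" for l
      by (simp only: complex_norm_square) simp
    then have "(\<lambda>k. complex_of_real (2 * pi * (a k * radius n ^ k)\<^sup>2)) sums (LINT l|circle_measure. of_real ((norm (?F l))\<^sup>2))"
      using integral_F_cnj_F_cis[OF radius, of n 0] by (simp add: zero_ext_def power2_eq_square mult_ac)
    then have s: "(\<lambda>k. (2 * pi * (a k * radius n ^ k)\<^sup>2)) sums (LINT l|circle_measure. (norm (?F l))\<^sup>2)"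
      by (simp only: integral_complex_of_real sums_of_real_iff)
    have "(\<Sum>k<K. 2 * pi * (a k * radius n ^ k)\<^sup>2) \<le> (LINT l|circle_measure. (norm (?F l))\<^sup>2)"
      using sum_le_suminf[OF sums_summable[OF s], of "{..<K}"] sums_unique[OF s] by simp
    also have "\<dots> \<le> ?I"
    proof (rule integral_mono_AE')
      show "AE l in circle_measure. (norm (?F l))\<^sup>2 \<le> (D l)\<^sup>2"
        using dominated_radius by eventually_elim (simp add: power_mono)
    qed (auto simp: D_square_integrable)
    finally show ?thesis .
  qed
  moreover have "(\<lambda>n. \<Sum>k<K. 2 * pi * (a k * radius n ^ k)\<^sup>2) \<longlonglongrightarrow> (\<Sum>k<K. 2 * pi * (a k * 1 ^ k)\<^sup>2)"
    by (intro tendsto_intros radius_tendsto)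
  ultimately have "(\<Sum>k<K. 2 * pi * (a k * 1 ^ k)\<^sup>2) \<le> ?I"
    by (intro LIMSEQ_le_const2) auto
  then show "(\<Sum>k<K. (a k)\<^sup>2) \<le> ?I / (2 * pi)"
    by (simp add: sum_distrib_left field_simps)
qed simp

lemma summable_autocorrelation: "summable (\<lambda>k. \<bar>a k * zero_ext a (int k - h)\<bar>)"
proof (rule summable_comparison_test')
  show "summable (\<lambda>k. (a k)\<^sup>2 + (zero_ext a (int k - h))\<^sup>2)"
    by (intro summable_add summable_coefficients_square summable_zero_ext_shift)
  fix k
  have "0 \<le> \<bar>a k\<bar> * \<bar>zero_ext a (int k - h)\<bar>" by simp
  moreover have "2 * \<bar>a k\<bar> * \<bar>zero_ext a (int k - h)\<bar> \<le> (a k)\<^sup>2 + (zero_ext a (int k - h))\<^sup>2"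
    using sum_squares_bound[of "\<bar>a k\<bar>" "\<bar>zero_ext a (int k - h)\<bar>"] by simp
  ultimately show "norm \<bar>a k * zero_ext a (int k - h)\<bar> \<le> (a k)\<^sup>2 + (zero_ext a (int k - h))\<^sup>2"
    unfolding real_norm_def abs_abs abs_mult by linarith
qed

text \<open>The integrals converge by domination; the series on the other side converge by Tannery's theorem,
  since square summability makes the autocorrelation series absolutely convergent.\<close>

lemma fourier_coefficient_norm_B_square:
  "(LINT l|circle_measure. of_real ((norm (B l))\<^sup>2) * cis (of_int h * l))
     = of_real (2 * pi * (\<Sum>k. a k * zero_ext a (int k - h)))"
proof -
  let ?t = "\<lambda>k n. complex_of_real (2 * pi * (a k * radius n ^ k * (zero_ext a (int k - h) * radius n ^ nat (int k - h))))"
  let ?b = "\<lambda>k. complex_of_real (2 * pi * (a k * 1 ^ k * (zero_ext a (int k - h) * 1 ^ nat (int k - h))))"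
  have "(\<lambda>n. \<Sum>k. ?t k n) \<longlonglongrightarrow> (\<Sum>k. ?b k)"
  proof (rule conjunct2[OF conjunct2[OF tannerys_theorem]])
    show "?t k \<longlonglongrightarrow> ?b k" for k
      by (intro tendsto_intros radius_tendsto)
    show "summable (\<lambda>k. 2 * pi * \<bar>a k * zero_ext a (int k - h)\<bar>)"
      by (intro summable_mult summable_autocorrelation)
    have "norm (?t k n) \<le> 2 * pi * \<bar>a k * zero_ext a (int k - h)\<bar>" for k n
    proof -
      have "norm (?t k n) = 2 * pi * \<bar>a k * zero_ext a (int k - h)\<bar> * (radius n ^ k * radius n ^ nat (int k - h))"
        using radius[of n] by (simp add: abs_mult norm_mult norm_power)
      also have "\<dots> \<le> 2 * pi * \<bar>a k * zero_ext a (int k - h)\<bar> * (1 * 1)"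
        using radius[of n] by (intro mult_left_mono mult_mono power_le_one) auto
      finally show ?thesis by simp
    qed
    then show "\<forall>\<^sub>F (k, n) in sequentially \<times>\<^sub>F sequentially. norm (?t k n) \<le> 2 * pi * \<bar>a k * zero_ext a (int k - h)\<bar>"
      by (intro always_eventually) auto
  qed auto
  moreover have "(\<Sum>k. ?t k n) = (LINT l|circle_measure. F (of_real (radius n) * cis (- l)) * (cnj (F (of_real (radius n) * cis (- l))) * cis (of_int h * l)))" for n
    using sums_unique[OF integral_F_cnj_F_cis[OF radius]] by simp
  ultimately have "(LINT l|circle_measure. of_real ((norm (B l))\<^sup>2) * cis (of_int h * l)) = (\<Sum>k. ?b k)"
    using integral_F_norm_B_limit[of h] LIMSEQ_unique by auto
  also have "\<dots> = of_real (\<Sum>k. 2 * pi * (a k * zero_ext a (int k - h)))"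
    using summable_rabs_cancel[OF summable_autocorrelation[of h]] by (subst suminf_of_real) (auto intro!: summable_mult)
  also have "\<dots> = of_real (2 * pi * (\<Sum>k. a k * zero_ext a (int k - h)))"
    using summable_rabs_cancel[OF summable_autocorrelation[of h]] by (subst suminf_mult) auto
  finally show ?thesis .
qed

end

section \<open>The filter on the unit circle\<close>

text \<open>A translate and a reflected translate of \<open>x powr (- a)\<close> on \<open>[0, K]\<close> cover the two sides of the
  singularity \<open>c\<close>; \<open>K\<close> is large enough for both to reach across \<open>(-pi, pi]\<close>.\<close>

lemma integrable_abs_diff_powr:
  fixes c a :: real
  assumes "a < 1"
  shows "integrable circle_measure (\<lambda>l. \<bar>l - c\<bar> powr (- a))"
proof -
  define K where "K = pi + \<bar>c\<bar>"
  define f where "f x = indicator {0..K} x * x powr (- a)" for x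
  have "(\<lambda>x. x powr (- a)) integrable_on {0..K}"
    unfolding K_def using assms by (intro integrable_on_powr_from_0) auto
  then have "(\<lambda>x. x powr (- a)) absolutely_integrable_on {0..K}"
    by (rule nonnegative_absolutely_integrable_1) auto
  then have "integrable lebesgue f"
    by (simp add: set_integrable_def f_def[abs_def])
  moreover have [measurable]: "f \<in> borel_measurable borel"
    unfolding f_def by measurable
  ultimately have f: "integrable lborel f"
    by (subst (asm) integrable_completion) auto
  have "integrable lborel (\<lambda>l. f (- c + 1 * l) + f (c + (- 1) * l))"
    by (intro Bochner_Integration.integrable_add lborel_integrable_real_affine[OF f]) auto
  then have "set_integrable lborel {-pi<..pi} (\<lambda>l. f (- c + 1 * l) + f (c + (- 1) * l))"
    unfolding set_integrable_def by (intro integrable_mult_indicator) auto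
  then have i: "integrable circle_measure (\<lambda>l. f (- c + 1 * l) + f (c + (- 1) * l))"
    by (simp add: integrable_circle_iff)
  have m: "(\<lambda>l. \<bar>l - c\<bar> powr (- a)) \<in> borel_measurable circle_measure"
    by (intro borel_measurable_circle) measurable
  show ?thesis
  proof (rule Bochner_Integration.integrable_bound[OF i m])
    have "\<bar>l - c\<bar> powr (- a) \<le> f (- c + 1 * l) + f (c + (- 1) * l)" if "l \<in> {-pi<..pi}" for l
    proof (cases "l \<ge> c")
      case True
      then show ?thesis using that by (auto simp: f_def K_def indicator_def)
    next
      case False
      then show ?thesis using that by (auto simp: f_def K_def indicator_def abs_if)
    qed
    moreover have "0 \<le> f x" for x by (simp add: f_def)
    ultimately show "AE l in circle_measure. norm (\<bar>l - c\<bar> powr (- a)) \<le> norm (f (- c + 1 * l) + f (c + (- 1) * l))"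
      unfolding circle_measure_def by (subst AE_restrict_space_iff) (auto intro!: AE_I2)
  qed
qed

text \<open>From \<open>|sin y - y| \<le> |y|\<^sup>3/6\<close> and \<open>y\<^sup>2 \<le> 4\<close>. Any positive constant in place of \<open>1/3\<close> would
  serve to compare \<open>|1 - e\<^bsup>ix\<^esup>|\<close> with the distance from \<open>x\<close> to its nearest zero.\<close>

lemma abs_sin_ge:
  assumes "\<bar>y\<bar> \<le> pi / 2"
  shows "\<bar>y\<bar> / 3 \<le> \<bar>sin y\<bar>"
proof -
  have "\<bar>sin y - (\<Sum>m<3. sin_coeff m * y ^ m)\<bar> \<le> inverse (fact 3) * \<bar>y\<bar> ^ 3"
    by (rule Maclaurin_sin_bound)
  then have "\<bar>sin y - y\<bar> \<le> \<bar>y\<bar> ^ 3 / 6"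
    by (simp add: numeral_3_eq_3 sin_coeff_def fact_numeral field_simps)
  moreover have "\<bar>y\<bar> ^ 3 \<le> 4 * \<bar>y\<bar>"
  proof -
    have "\<bar>y\<bar> ^ 2 \<le> 2 ^ 2"
      using assms pi_half_less_two by (intro power_mono) auto
    then show ?thesis
      using mult_right_mono[of "\<bar>y\<bar> ^ 2" 4 "\<bar>y\<bar>"] by (simp add: power2_eq_square power3_eq_cube)
  qed
  ultimately show ?thesis by (simp add: abs_if split: if_splits)
qed

lemma norm_one_minus_cis: "norm (1 - cis x) = 2 * \<bar>sin (x / 2)\<bar>"
  using dist_exp_i_1[of x] by (simp add: cis_conv_exp norm_minus_commute)

text \<open>The zeros of \<open>1 - e\<^bsup>isl\<^esup>\<close> in \<open>l\<close> are the points \<open>c\<^sub>j = 2 pi j / s\<close>. Near each of them the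
  modulus is comparable to \<open>|l - c\<^sub>j|\<close>, so for \<open>a > 0\<close> its power is bounded by a finite sum of
  integrable singularities \<open>|l - c\<^sub>j| powr (- a)\<close>. For \<open>a \<le> 0\<close> the function is bounded.\<close>

lemma integrable_norm_one_minus_cis_powr:
  assumes s: "s \<ge> 1" and a: "a < 1"
  shows "integrable circle_measure (\<lambda>l. norm (1 - cis (real s * l)) powr (- a))"
proof -
  have m: "(\<lambda>l. norm (1 - cis (real s * l)) powr (- a)) \<in> borel_measurable circle_measure"
    by measurable
  show ?thesis
  proof (cases "a \<le> 0")
    case True
    show ?thesis
    proof (rule circle.integrable_const_bound[OF _ m])
      have "norm (1 - cis x) \<le> 2" for x
        using norm_triangle_ineq4[of 1 "cis x"] by simp
      then show "AE l in circle_measure. norm (norm (1 - cis (real s * l)) powr (- a)) \<le> 2 powr (- a)"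
        using True by (auto intro!: powr_mono2)
    qed
  next
    case False
    let ?c = "\<lambda>j. 2 * pi * of_int j / real s"
    let ?g = "\<lambda>l. \<Sum>j\<in>{- int s..int s}. 3 powr a * \<bar>l - ?c j\<bar> powr (- a)"
    have g: "integrable circle_measure ?g"
      using a by (intro Bochner_Integration.integrable_sum integrable_mult_right integrable_abs_diff_powr)
    show ?thesis
    proof (rule Bochner_Integration.integrable_bound[OF g m])
      have "norm (1 - cis (real s * l)) powr (- a) \<le> ?g l" if l: "l \<in> {-pi<..pi}" for l
      proof -
        have third_le_trans: "v / 3 \<le> n" if "2 * u / 3 \<le> n" "2 * u = w" "1 * v \<le> w" for u v w n :: real
          using that by linarith
        \<comment> \<open>\<open>c\<^sub>j\<close> is the zero nearest to \<open>l\<close>; for \<open>|l| \<le> pi\<close> its index is at most \<open>s\<close> in modulus.\<close>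
        let ?x = "real s * l / (2 * pi)"
        define j where "j = round ?x"
        have ab: "\<bar>l\<bar> \<le> pi" using l by auto
        have "\<bar>?x\<bar> = real s * \<bar>l\<bar> / (2 * pi)" by (simp add: abs_mult)
        also have "\<dots> \<le> real s * pi / (2 * pi)"
          using ab by (intro divide_right_mono mult_left_mono) auto
        finally have x: "\<bar>?x\<bar> \<le> real s / 2" by simp
        have jx: "\<bar>of_int j - ?x\<bar> \<le> 1 / 2"
          unfolding j_def by (rule of_int_round_abs_le)
        have "\<bar>real_of_int j\<bar> \<le> real s"
          using x jx s by linarith
        then have j: "j \<in> {- int s..int s}" by auto
        have *: "real s * l / 2 = (?x - of_int j) * pi + of_int j * pi"
          by (simp add: field_simps)
        have "\<bar>(?x - of_int j) * pi\<bar> \<le> pi / 2"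
          using jx mult_right_mono[of "\<bar>?x - of_int j\<bar>" "1/2" pi] by (simp add: abs_mult abs_minus_commute)
        then have "\<bar>(?x - of_int j) * pi\<bar> / 3 \<le> \<bar>sin ((?x - of_int j) * pi)\<bar>"
          by (rule abs_sin_ge)
        also have "\<bar>sin ((?x - of_int j) * pi)\<bar> = \<bar>sin (real s * l / 2)\<bar>"
        proof -
          have "sin (of_int j * pi) = 0" by (simp add: sin_times_pi_eq_0)
          then show ?thesis
            unfolding * sin_add by (simp add: abs_mult sin_zero_abs_cos_one)
        qed
        finally have "2 * \<bar>(?x - of_int j) * pi\<bar> / 3 \<le> norm (1 - cis (real s * l))"
          by (simp add: norm_one_minus_cis)
        moreover have "2 * \<bar>(?x - of_int j) * pi\<bar> = real s * \<bar>l - ?c j\<bar>"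
        proof -
          have "2 * ((?x - of_int j) * pi) = real s * (l - ?c j)"
            using s by (simp add: field_simps)
          then have "\<bar>2 * ((?x - of_int j) * pi)\<bar> = \<bar>real s * (l - ?c j)\<bar>" by (rule arg_cong)
          then show ?thesis by (simp add: abs_mult)
        qed
        moreover have "1 * \<bar>l - ?c j\<bar> \<le> real s * \<bar>l - ?c j\<bar>"
          using s by (intro mult_right_mono) auto
        ultimately have le: "\<bar>l - ?c j\<bar> / 3 \<le> norm (1 - cis (real s * l))"
          by (rule third_le_trans)
        have "norm (1 - cis (real s * l)) powr (- a) \<le> 3 powr a * \<bar>l - ?c j\<bar> powr (- a)"
        \<comment> \<open>At a zero itself the left-hand side is \<open>0 powr (- a) = 0\<close>.\<close>
        proof (cases "l = ?c j")
          case True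
          then have "cis (real s * l) = 1"
            using s cis_multiple_2pi[of "of_int j"] by simp
          then show ?thesis by simp
        next
          case ne: False
          have "norm (1 - cis (real s * l)) powr (- a) \<le> (\<bar>l - ?c j\<bar> / 3) powr (- a)"
            using le ne False by (intro powr_mono2') auto
          also have "\<dots> = 3 powr a * \<bar>l - ?c j\<bar> powr (- a)"
            by (simp add: powr_divide powr_minus field_simps)
          finally show ?thesis .
        qed
        also have "\<dots> \<le> ?g l"
          using j by (intro member_le_sum) auto
        finally show ?thesis .
      qed
      then show "AE l in circle_measure. norm (norm (1 - cis (real s * l)) powr (- a)) \<le> norm (?g l)"
        unfolding circle_measure_def
        by (subst AE_restrict_space_iff) (auto intro!: AE_I2 order_trans[OF _ abs_ge_self])
    qed
  qed
qed

lemma AE_cis_neq_one: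
  assumes "s \<ge> 1"
  shows "AE l in circle_measure. cis (real s * l) \<noteq> 1"
proof (rule AE_circleI)
  have "{l. cis (real s * l) = 1} \<subseteq> range (\<lambda>j::int. 2 * pi * of_int j / real s)"
  proof
    fix l assume "l \<in> {l. cis (real s * l) = 1}"
    then have "sin (real s * l / 2) = 0"
      using norm_one_minus_cis[of "real s * l"] by simp
    then obtain j :: int where "real s * l / 2 = of_int j * pi"
      by (auto simp: sin_zero_iff_int2)
    then have "l = 2 * pi * of_int j / real s"
      using assms by (simp add: field_simps)
    then show "l \<in> range (\<lambda>j::int. 2 * pi * of_int j / real s)" by blast
  qed
  then have "countable {l. cis (real s * l) = 1}"
    by (rule countable_subset) auto
  then show "AE l in lborel. cis (real s * l) \<noteq> 1"
    using AE_not_in[OF countable_imp_null_set_lborel] by fastforce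
qed

text \<open>By the triangle inequality through \<open>r w\<close>: its distance to \<open>w\<close> is \<open>1 - r\<close>, which is at most its
  distance to 1. Hence the singularity of the filter at radius \<open>r\<close> is controlled by the one at radius 1.\<close>

lemma norm_one_minus_le_twice:
  fixes w :: complex
  assumes "norm w = 1" "0 \<le> r" "r \<le> 1"
  shows "norm (1 - w) \<le> 2 * norm (1 - of_real r * w)"
proof -
  have "1 - r \<le> norm (1 - of_real r * w)"
    using norm_triangle_ineq2[of 1 "of_real r * w"] assms by (simp add: norm_mult)
  moreover have "norm (1 - w) \<le> norm (1 - of_real r * w) + norm (of_real r * w - w)"
    using norm_triangle_ineq[of "1 - of_real r * w" "of_real r * w - w"] by simp
  moreover have "norm (of_real r * w - w) = 1 - r"
  proof -
    have "of_real r * w - w = of_real (r - 1) * w" by (simp add: algebra_simps)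
    then show ?thesis using assms by (simp only: norm_mult norm_of_real) simp
  qed
  ultimately show ?thesis by linarith
qed

lemma norm_gpow_complex: "norm (gpow w (complex_of_real a)) = gpow (norm w) a"
  by (simp add: gpow_def norm_powr_real_powr')

lemma gpow_norm_square: "(gpow (norm w) a)\<^sup>2 = gpow (norm (w::complex)) (2 * a)"
  by (auto simp: gpow_def power2_eq_square simp flip: powr_add)

text \<open>For \<open>|w| \<le> 1\<close> the number \<open>1 - w\<close> has nonnegative real part, so it meets the branch cut of the
  principal power only at 0.\<close>

lemma one_minus_notin_nonpos_Reals:
  fixes w :: complex
  assumes "norm w \<le> 1" "w \<noteq> 1"
  shows "1 - w \<notin> \<real>\<^sub>\<le>\<^sub>0"
proof
  assume "1 - w \<in> \<real>\<^sub>\<le>\<^sub>0"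
  then have "1 \<le> Re w" "Im w = 0" by (auto simp: complex_nonpos_Reals_iff)
  moreover have "Re w \<le> 1" using complex_Re_le_cmod[of w] assms by simp
  ultimately have "w = 1" by (simp add: complex_eq_iff)
  with assms show False by simp
qed

lemma tendsto_sfie_filter:
  assumes "cpoly \<beta> z \<noteq> 0" "norm (z ^ s) \<le> 1" "z ^ s \<noteq> 1"
    and f: "(f \<longlongrightarrow> z) net"
  shows "((\<lambda>x. sfie_filter \<alpha> \<beta> s d (f x)) \<longlongrightarrow> sfie_filter \<alpha> \<beta> s d z) net"
proof -
  have p: "((\<lambda>x. cpoly P (f x)) \<longlongrightarrow> cpoly P z) net" for P
    by (rule continuous_on_tendsto_compose[OF _ f, of UNIV]) (auto intro!: continuous_intros)
  have "((\<lambda>x. gpow (1 - f x ^ s) (complex_of_real (- d))) \<longlongrightarrow> gpow (1 - z ^ s) (of_real (- d))) net"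
  proof (cases "d = 0")
    case False
    have "((\<lambda>x. (1 - f x ^ s) powr (complex_of_real (- d))) \<longlongrightarrow> (1 - z ^ s) powr (of_real (- d))) net"
      by (intro tendsto_powr_complex tendsto_intros f one_minus_notin_nonpos_Reals assms)
    then show ?thesis using False by (simp add: gpow_def)
  qed (simp add: gpow_def)
  then show ?thesis
    unfolding sfie_filter_def by (intro tendsto_intros p assms)
qed

lemma cpoly_ratio_bounded:
  assumes "\<And>z. norm z \<le> 1 \<Longrightarrow> cpoly \<beta> z \<noteq> 0"
  obtains C where "0 \<le> C" "\<And>z. norm z \<le> 1 \<Longrightarrow> norm (cpoly \<alpha> z / cpoly \<beta> z) \<le> C"
proof -
  have "continuous_on (cball 0 1) (\<lambda>z. cpoly \<alpha> z / cpoly \<beta> z)"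
    by (intro continuous_intros) (use assms in auto)
  then have "bounded ((\<lambda>z. cpoly \<alpha> z / cpoly \<beta> z) ` cball 0 1)"
    by (intro compact_imp_bounded compact_continuous_image) auto
  then obtain C where "\<forall>x \<in> (\<lambda>z. cpoly \<alpha> z / cpoly \<beta> z) ` cball 0 1. norm x \<le> C"
    unfolding bounded_iff by (elim exE)
  then have C: "norm (cpoly \<alpha> z / cpoly \<beta> z) \<le> C" if "norm z \<le> 1" for z
    using that by (elim ballE[of _ _ "cpoly \<alpha> z / cpoly \<beta> z"]) (auto simp del: norm_divide)
  moreover have "0 \<le> C" using C[of 0] norm_ge_zero order_trans by (metis norm_zero zero_le_one)
  ultimately show ?thesis using that by blast
qed

lemma Lambda_altdef: "Lambda \<alpha> \<beta> s d l = sfie_filter \<alpha> \<beta> s d (cis (- l))"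
  by (simp add: Lambda_def cis_conv_exp)

lemma cis_power_eq: "cis (- l) ^ s = cis (real s * (- l))"
  by (simp add: Complex.DeMoivre)

lemma cis_minus_eq_1_iff: "cis (- x) = 1 \<longleftrightarrow> cis x = 1"
  by (auto simp: complex_eq_iff)

text \<open>The boundary function is continuous off the closed set where \<open>1 - e\<^bsup>-isl\<^esup>\<close> vanishes. On that set
  the fractional power has one constant value, so the restriction is continuous there too.\<close>

lemma Lambda_measurable:
  assumes b: "\<And>z. norm z \<le> 1 \<Longrightarrow> cpoly \<beta> z \<noteq> 0"
  shows "Lambda \<alpha> \<beta> s d \<in> borel_measurable borel"
proof -
  let ?S = "{l::real. cis (- l) ^ s \<noteq> 1}"
  let ?p = "\<lambda>l. cpoly \<alpha> (cis (- l)) / cpoly \<beta> (cis (- l)) * gpow 0 (complex_of_real (- d))"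
  have "closed {l. cis (- l) ^ s = 1}"
    by (intro closed_Collect_eq continuous_intros)
  moreover have "?S = - {l. cis (- l) ^ s = 1}" by auto
  ultimately have S: "open ?S" by (simp add: open_Compl)
  have "(\<lambda>l. if l \<in> ?S then Lambda \<alpha> \<beta> s d l else ?p l) \<in> borel_measurable borel"
  proof (rule borel_measurable_continuous_on_if)
    show "continuous_on ?S (Lambda \<alpha> \<beta> s d)"
      unfolding continuous_on_def Lambda_altdef
    proof (intro ballI)
      fix l assume l: "l \<in> ?S"
      show "((\<lambda>x. sfie_filter \<alpha> \<beta> s d (cis (- x))) \<longlongrightarrow> sfie_filter \<alpha> \<beta> s d (cis (- l))) (at l within ?S)"
        by (rule tendsto_sfie_filter) (use b l in \<open>auto simp: norm_power intro!: tendsto_intros\<close>)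
    qed
    show "continuous_on (- ?S) ?p"
      by (intro continuous_intros) (use b in auto)
  qed (use S in auto)
  moreover have "(\<lambda>l. if l \<in> ?S then Lambda \<alpha> \<beta> s d l else ?p l) = Lambda \<alpha> \<beta> s d"
    by (auto simp: Lambda_altdef sfie_filter_def fun_eq_iff)
  ultimately show ?thesis by simp
qed

text \<open>The majorant adds the two bounds for the power: \<open>2 powr (- d)\<close>, valid for \<open>d \<le> 0\<close>, and
  half the boundary modulus to the power \<open>- d\<close>, valid for \<open>d > 0\<close>. Adding them treats all signs of \<open>d\<close>
  at once.\<close>

lemma sfie_hardy_boundary:
  assumes s: "s \<ge> 1" and d: "d < 1 / 2"
    and b: "\<And>z. norm z \<le> 1 \<Longrightarrow> cpoly \<beta> z \<noteq> 0"
    and series: "\<And>z. norm z < 1 \<Longrightarrow>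
          (\<lambda>k. complex_of_real (lam k) * z ^ k) sums sfie_filter \<alpha> \<beta> s d z"
  shows "\<exists>D. hardy_boundary lam (sfie_filter \<alpha> \<beta> s d) (Lambda \<alpha> \<beta> s d) D"
proof -
  obtain C where C: "0 \<le> C" "\<And>z. norm z \<le> 1 \<Longrightarrow> norm (cpoly \<alpha> z / cpoly \<beta> z) \<le> C"
    using cpoly_ratio_bounded b by metis
  let ?n = "\<lambda>l. norm (1 - cis (real s * l)) / 2"
  define D where "D l = C * (2 powr (- d) + ?n l powr (- d))" for l
  have norm_flip: "norm (1 - cis (real s * (- l))) = norm (1 - cis (real s * l))" for l
    by (simp add: norm_one_minus_cis)
  have "hardy_boundary lam (sfie_filter \<alpha> \<beta> s d) (Lambda \<alpha> \<beta> s d) D"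
  proof
    show "AE l in circle_measure. \<forall>r. 0 \<le> r \<and> r < 1 \<longrightarrow> norm (sfie_filter \<alpha> \<beta> s d (of_real r * cis (- l))) \<le> D l"
      using AE_cis_neq_one[OF s]
    proof (eventually_elim, intro allI impI)
      fix l r :: real assume l: "cis (real s * l) \<noteq> 1" and r: "0 \<le> r \<and> r < 1"
      let ?z = "of_real r * cis (- l)"
      let ?w = "1 - ?z ^ s"
      have n1: "norm ?z \<le> 1" using r by (simp add: norm_mult)
      have zs: "?z ^ s = of_real (r ^ s) * cis (real s * (- l))"
        by (simp add: power_mult_distrib cis_power_eq)
      have up: "norm ?w \<le> 2"
        using norm_triangle_ineq4[of 1 "?z ^ s"] n1 power_le_one[of "norm ?z" s] by (simp add: norm_power)
      have low: "?n l \<le> norm ?w"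
        using norm_one_minus_le_twice[of "cis (real s * (- l))" "r ^ s"] r
        unfolding zs norm_flip by (simp add: power_le_one)
      have pos: "0 < ?n l" using l by simp
      have "gpow (norm ?w) (- d) \<le> 2 powr (- d) + ?n l powr (- d)"
      proof (cases "d > 0")
        case True
        then have "norm ?w powr (- d) \<le> ?n l powr (- d)"
          using low pos by (intro powr_mono2') auto
        then show ?thesis using True by (simp add: gpow_def add_increasing)
      next
        case False
        then have "norm ?w powr (- d) \<le> 2 powr (- d)"
          using up by (intro powr_mono2) auto
        then show ?thesis using False by (simp add: gpow_def add_increasing2)
      qed
      then have "norm (cpoly \<alpha> ?z / cpoly \<beta> ?z) * gpow (norm ?w) (- d) \<le> D l"
        unfolding D_def using C n1 by (intro mult_mono) (auto simp: gpow_def)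
      then show "norm (sfie_filter \<alpha> \<beta> s d ?z) \<le> D l"
        unfolding sfie_filter_def norm_mult[of "cpoly \<alpha> ?z / cpoly \<beta> ?z"] norm_gpow_complex .
    qed
    show "AE l in circle_measure. ((\<lambda>r. sfie_filter \<alpha> \<beta> s d (of_real r * cis (- l))) \<longlongrightarrow> Lambda \<alpha> \<beta> s d l) (at_left 1)"
      using AE_cis_neq_one[OF s]
    proof eventually_elim
      fix l assume l: "cis (real s * l) \<noteq> 1"
      have "((\<lambda>r. complex_of_real r * cis (- l)) \<longlongrightarrow> of_real 1 * cis (- l)) (at_left 1)"
        by (intro tendsto_intros)
      then show "((\<lambda>r. sfie_filter \<alpha> \<beta> s d (of_real r * cis (- l))) \<longlongrightarrow> Lambda \<alpha> \<beta> s d l) (at_left 1)"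
        unfolding Lambda_altdef
        by (intro tendsto_sfie_filter) (use l b cis_minus_eq_1_iff[of "real s * l"] in \<open>auto simp: norm_power cis_power_eq\<close>)
    qed
    show "Lambda \<alpha> \<beta> s d \<in> borel_measurable circle_measure"
      by (intro borel_measurable_circle Lambda_measurable b)
    show Dm: "D \<in> borel_measurable circle_measure"
      unfolding D_def by measurable
    have "integrable circle_measure (\<lambda>l. C\<^sup>2 * (2 * (2 powr (- d))\<^sup>2 + 2 * ((1/2) powr (- (2 * d)) * norm (1 - cis (real s * l)) powr (- (2 * d)))))"
      using d by (intro integrable_mult_right Bochner_Integration.integrable_add integrable_norm_one_minus_cis_powr s) auto
    moreover have "(\<lambda>l. (D l)\<^sup>2) \<in> borel_measurable circle_measure" using Dm by measurable
    ultimately show "integrable circle_measure (\<lambda>l. (D l)\<^sup>2)"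
    proof (rule Bochner_Integration.integrable_bound, intro AE_I2)
      fix l
      have "(x + y)\<^sup>2 \<le> 2 * x\<^sup>2 + 2 * y\<^sup>2" for x y :: real
        using sum_squares_bound[of x y] by (simp add: power2_sum)
      then have "(D l)\<^sup>2 \<le> C\<^sup>2 * (2 * (2 powr (- d))\<^sup>2 + 2 * (?n l powr (- d))\<^sup>2)"
        unfolding D_def power_mult_distrib by (intro mult_left_mono) auto
      also have "(?n l powr (- d))\<^sup>2 = ?n l powr (- (2 * d))"
        by (simp add: power2_eq_square flip: powr_add)
      also have "?n l powr (- (2 * d)) = (1/2) powr (- (2 * d)) * norm (1 - cis (real s * l)) powr (- (2 * d))"
        by (simp flip: powr_mult)
      finally show "norm ((D l)\<^sup>2) \<le> norm (C\<^sup>2 * (2 * (2 powr (- d))\<^sup>2 + 2 * ((1/2) powr (- (2 * d)) * norm (1 - cis (real s * l)) powr (- (2 * d)))))"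
        by simp
    qed
  qed (rule series)
  then show ?thesis by blast
qed

text \<open>The coefficients are real and conjugation commutes with the principal power off the branch cut. This
  is what makes the spectral densities even.\<close>

lemma Lambda_minus: "Lambda \<alpha> \<beta> s d (- l) = cnj (Lambda \<alpha> \<beta> s d l)"
proof -
  have p: "cpoly P (cnj z) = cnj (cpoly P z)" for P z
    by (subst poly_cnj_real) (auto simp: coeff_map_poly)
  have "gpow (cnj w) (of_real (- d)) = cnj (gpow w (of_real (- d)))" if "0 \<le> Re w" for w
    using that by (simp add: gpow_def cnj_powr)
  moreover have "0 \<le> Re (1 - cis (- l) ^ s)"
    using complex_Re_le_cmod[of "cis (- l) ^ s"] by (simp add: norm_power)
  ultimately have "gpow (cnj (1 - cis (- l) ^ s)) (complex_of_real (- d)) = cnj (gpow (1 - cis (- l) ^ s) (of_real (- d)))"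
    by blast
  then show ?thesis
    unfolding Lambda_altdef sfie_filter_def using p[of _ "cis (- l)"]
    by (simp add: cis_cnj)
qed

lemma norm_Lambda_square:
  "(norm (Lambda \<alpha> \<beta> s d l))\<^sup>2
     = (norm (cpoly \<alpha> (exp (- \<i> * of_real l))))\<^sup>2 / (norm (cpoly \<beta> (exp (- \<i> * of_real l))))\<^sup>2
       * gpow (norm (1 - exp (- \<i> * of_nat s * of_real l))) (- 2 * d)"
proof -
  have "exp (- \<i> * of_real l) ^ s = exp (- \<i> * of_nat s * of_real l)"
    by (simp add: mult_ac flip: exp_of_nat_mult)
  then show ?thesis
    unfolding Lambda_def sfie_filter_def norm_mult norm_gpow_complex power_mult_distrib gpow_norm_square
    by (simp add: norm_divide power_divide)
qed

section \<open>Orthogonal series in mean square\<close>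

lemma integrable_mult_of_square_integrable:
  fixes U V :: "'a \<Rightarrow> real"
  assumes [measurable]: "U \<in> borel_measurable M" "V \<in> borel_measurable M"
    and "integrable M (\<lambda>x. (U x)\<^sup>2)" "integrable M (\<lambda>x. (V x)\<^sup>2)"
  shows "integrable M (\<lambda>x. U x * V x)"
proof (rule Bochner_Integration.integrable_bound)
  show "integrable M (\<lambda>x. (U x)\<^sup>2 + (V x)\<^sup>2)"
    using assms by (intro Bochner_Integration.integrable_add)
  show "AE x in M. norm (U x * V x) \<le> norm ((U x)\<^sup>2 + (V x)\<^sup>2)"
  proof (rule AE_I2)
    fix x
    have "0 \<le> \<bar>U x\<bar> * \<bar>V x\<bar>" by simp
    moreover have "2 * \<bar>U x\<bar> * \<bar>V x\<bar> \<le> (U x)\<^sup>2 + (V x)\<^sup>2"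
      using sum_squares_bound[of "\<bar>U x\<bar>" "\<bar>V x\<bar>"] by simp
    ultimately show "norm (U x * V x) \<le> norm ((U x)\<^sup>2 + (V x)\<^sup>2)"
      unfolding real_norm_def abs_mult by linarith
  qed
qed measurable

lemma integrable_square_add:
  fixes U V :: "'a \<Rightarrow> real"
  assumes "U \<in> borel_measurable M" "V \<in> borel_measurable M"
    and "integrable M (\<lambda>x. (U x)\<^sup>2)" "integrable M (\<lambda>x. (V x)\<^sup>2)"
  shows "integrable M (\<lambda>x. (U x + V x)\<^sup>2)"
  unfolding power2_sum mult.assoc
  using assms by (intro Bochner_Integration.integrable_add integrable_mult_right integrable_mult_of_square_integrable)

lemma integrable_square_sum:
  fixes U :: "'i \<Rightarrow> 'a \<Rightarrow> real"
  assumes "\<And>i. i \<in> I \<Longrightarrow> U i \<in> borel_measurable M" "\<And>i. i \<in> I \<Longrightarrow> integrable M (\<lambda>x. (U i x)\<^sup>2)"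
  shows "integrable M (\<lambda>x. (\<Sum>i\<in>I. U i x)\<^sup>2)"
  using assms
proof (induction I rule: infinite_finite_induct)
  case (insert i I)
  then have "integrable M (\<lambda>x. (U i x + (\<Sum>i\<in>I. U i x))\<^sup>2)"
    by (intro integrable_square_add borel_measurable_sum) auto
  with insert show ?case by simp
qed auto

text \<open>The quadratic \<open>t \<mapsto> E (t U + V)\<^sup>2\<close> is nonnegative; evaluate it at its minimum. If
  \<open>E U\<^sup>2 = 0\<close> it is affine in \<open>t\<close>, hence constant.\<close>

lemma Cauchy_Schwarz_integral:
  fixes U V :: "'a \<Rightarrow> real"
  assumes m: "U \<in> borel_measurable M" "V \<in> borel_measurable M"
    and i: "integrable M (\<lambda>x. (U x)\<^sup>2)" "integrable M (\<lambda>x. (V x)\<^sup>2)"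
  shows "(LINT x|M. U x * V x)\<^sup>2 \<le> (LINT x|M. (U x)\<^sup>2) * (LINT x|M. (V x)\<^sup>2)"
proof -
  let ?A = "LINT x|M. (U x)\<^sup>2" and ?B = "LINT x|M. U x * V x" and ?C = "LINT x|M. (V x)\<^sup>2"
  have UV: "integrable M (\<lambda>x. U x * V x)"
    using assms by (rule integrable_mult_of_square_integrable)
  have q: "0 \<le> t\<^sup>2 * ?A + 2 * t * ?B + ?C" for t
  proof -
    have "0 \<le> (LINT x|M. (t * U x + V x)\<^sup>2)" by simp
    also have "(\<lambda>x. (t * U x + V x)\<^sup>2) = (\<lambda>x. t\<^sup>2 * (U x)\<^sup>2 + 2 * t * (U x * V x) + (V x)\<^sup>2)"
      by (simp add: fun_eq_iff power2_sum power_mult_distrib algebra_simps)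
    also have "(LINT x|M. t\<^sup>2 * (U x)\<^sup>2 + 2 * t * (U x * V x) + (V x)\<^sup>2) = t\<^sup>2 * ?A + 2 * t * ?B + ?C"
      using UV i by simp
    finally show ?thesis .
  qed
  show ?thesis
  proof (cases "?A = 0")
    case True
    have "?B = 0"
    proof (rule ccontr)
      assume "?B \<noteq> 0"
      then have "2 * (- (?C + 1) / (2 * ?B)) * ?B + ?C = - 1"
        by (simp add: field_simps)
      then show False using q[of "- (?C + 1) / (2 * ?B)"] True by simp
    qed
    then show ?thesis using True by simp
  next
    case False
    moreover have "0 \<le> ?A" by simp
    ultimately have "0 < ?A" by linarith
    moreover have "(- ?B / ?A)\<^sup>2 * ?A + 2 * (- ?B / ?A) * ?B + ?C = ?C - ?B\<^sup>2 / ?A"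
      using False by (simp add: power2_eq_square field_simps)
    ultimately have "0 \<le> ?C - ?B\<^sup>2 / ?A"
      using q[of "- ?B / ?A"] by metis
    then show ?thesis
      using \<open>0 < ?A\<close> by (simp add: field_simps)
  qed
qed

text \<open>Fatou's lemma, applied to \<open>(S m - S n)\<^sup>2\<close> as \<open>m\<close> grows, turns the Cauchy bound \<open>b n\<close> into a bound
  for the mean square distance from \<open>S n\<close> to the pointwise limit. Convergence of inner products then
  follows from the Cauchy--Schwarz inequality.\<close>

lemma AE_limit_square_integrable:
  fixes S :: "nat \<Rightarrow> 'a \<Rightarrow> real" and W :: "'a \<Rightarrow> real"
  assumes Sm [measurable]: "\<And>n. S n \<in> borel_measurable M" and Wm [measurable]: "W \<in> borel_measurable M"
    and S2: "\<And>n. integrable M (\<lambda>x. (S n x)\<^sup>2)"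
    and lim: "AE x in M. (\<lambda>n. S n x) \<longlonglongrightarrow> W x"
    and cauchy: "\<And>m n. n \<le> m \<Longrightarrow> (LINT x|M. (S m x - S n x)\<^sup>2) \<le> b n"
    and b: "b \<longlonglongrightarrow> 0"
  shows "integrable M (\<lambda>x. (W x)\<^sup>2)"
    and "V \<in> borel_measurable M \<Longrightarrow> integrable M (\<lambda>x. (V x)\<^sup>2) \<Longrightarrow>
           (\<lambda>n. LINT x|M. S n x * V x) \<longlonglongrightarrow> (LINT x|M. W x * V x)"
proof -
  have dS: "integrable M (\<lambda>x. (S m x - S n x)\<^sup>2)" for m n
    using integrable_square_add[of "S m" M "\<lambda>x. - S n x"] S2 by simp
  have b0: "0 \<le> b n" for n
    using cauchy[of n n] by simp
  have fatou: "(\<integral>\<^sup>+x. ennreal ((W x - S n x)\<^sup>2) \<partial>M) \<le> ennreal (b n)" for n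
  proof -
    have "(\<integral>\<^sup>+x. ennreal ((W x - S n x)\<^sup>2) \<partial>M) = (\<integral>\<^sup>+x. liminf (\<lambda>m. ennreal ((S m x - S n x)\<^sup>2)) \<partial>M)"
    proof (rule nn_integral_cong_AE)
      show "AE x in M. ennreal ((W x - S n x)\<^sup>2) = liminf (\<lambda>m. ennreal ((S m x - S n x)\<^sup>2))"
        using lim
      proof eventually_elim
        case (elim x)
        then have "(\<lambda>m. ennreal ((S m x - S n x)\<^sup>2)) \<longlonglongrightarrow> ennreal ((W x - S n x)\<^sup>2)"
          by (intro tendsto_ennrealI tendsto_intros)
        then show ?case
          by (intro lim_imp_Liminf[symmetric]) auto
      qed
    qed
    also have "\<dots> \<le> liminf (\<lambda>m. \<integral>\<^sup>+x. ennreal ((S m x - S n x)\<^sup>2) \<partial>M)"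
      by (rule nn_integral_liminf) measurable
    also have "\<dots> \<le> limsup (\<lambda>m. \<integral>\<^sup>+x. ennreal ((S m x - S n x)\<^sup>2) \<partial>M)"
      by (rule Liminf_le_Limsup) simp
    also have "\<dots> \<le> ennreal (b n)"
    proof (rule Limsup_bounded)
      show "\<forall>\<^sub>F m in sequentially. (\<integral>\<^sup>+x. ennreal ((S m x - S n x)\<^sup>2) \<partial>M) \<le> ennreal (b n)"
        using eventually_ge_at_top[of n]
        by eventually_elim (simp add: nn_integral_eq_integral[OF dS] cauchy ennreal_leI)
    qed
    finally show ?thesis .
  qed
  have d2: "integrable M (\<lambda>x. (W x - S n x)\<^sup>2)" for n
    using fatou[of n] by (intro integrableI_nonneg) (auto simp: less_top[symmetric] top_unique)
  then have dist: "(LINT x|M. (W x - S n x)\<^sup>2) \<le> b n" for n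
    using fatou[of n] b0[of n] by (subst (asm) nn_integral_eq_integral) auto
  show W2: "integrable M (\<lambda>x. (W x)\<^sup>2)"
    using integrable_square_add[of "\<lambda>x. W x - S 0 x" M "S 0"] d2 S2 by simp
  assume Vm [measurable]: "V \<in> borel_measurable M" and V2: "integrable M (\<lambda>x. (V x)\<^sup>2)"
  let ?C = "LINT x|M. (V x)\<^sup>2"
  have sq: "((LINT x|M. S n x * V x) - (LINT x|M. W x * V x))\<^sup>2 \<le> b n * ?C" for n
  proof -
    have "(LINT x|M. W x * V x) - (LINT x|M. S n x * V x) = (LINT x|M. (W x - S n x) * V x)"
      using integrable_mult_of_square_integrable[OF Wm Vm W2 V2]
        integrable_mult_of_square_integrable[OF Sm Vm S2 V2]
      by (simp add: left_diff_distrib)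
    then have "((LINT x|M. W x * V x) - (LINT x|M. S n x * V x))\<^sup>2 \<le> (LINT x|M. (W x - S n x)\<^sup>2) * ?C"
      using Cauchy_Schwarz_integral[of "\<lambda>x. W x - S n x" M V] d2 V2 by simp
    also have "\<dots> \<le> b n * ?C"
      using dist by (intro mult_right_mono) auto
    finally show ?thesis by (simp add: power2_commute)
  qed
  have "(\<lambda>n. ((LINT x|M. S n x * V x) - (LINT x|M. W x * V x))\<^sup>2) \<longlonglongrightarrow> 0"
  proof (rule tendsto_sandwich[of "\<lambda>_. 0"])
    show "(\<lambda>n. b n * ?C) \<longlonglongrightarrow> 0"
      using tendsto_mult[OF b tendsto_const[of ?C]] by simp
  qed (use sq in auto)
  then have "(\<lambda>n. (LINT x|M. S n x * V x) - (LINT x|M. W x * V x)) \<longlonglongrightarrow> 0"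
    by simp
  then show "(\<lambda>n. LINT x|M. S n x * V x) \<longlonglongrightarrow> (LINT x|M. W x * V x)"
    by (rule LIM_zero_cancel)
qed

text \<open>Orthogonality evaluates the mean square distance of two partial sums as \<open>v\<close> times a block of
  \<open>\<Sum>k. (a k)\<^sup>2\<close>, which is at most \<open>v\<close> times a tail of that series.\<close>

lemma orthogonal_series:
  fixes e :: "nat \<Rightarrow> 'a \<Rightarrow> real" and a :: "nat \<Rightarrow> real"
  assumes em [measurable]: "\<And>k. e k \<in> borel_measurable M" and e2: "\<And>k. integrable M (\<lambda>x. (e k x)\<^sup>2)"
    and orth: "\<And>j k. (LINT x|M. e j x * e k x) = (if j = k then v else 0)"
    and a: "summable (\<lambda>k. (a k)\<^sup>2)"
    and Wm [measurable]: "W \<in> borel_measurable M" and W: "AE x in M. (\<lambda>k. a k * e k x) sums W x"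
  shows "integrable M (\<lambda>x. (W x)\<^sup>2)"
    and "V \<in> borel_measurable M \<Longrightarrow> integrable M (\<lambda>x. (V x)\<^sup>2) \<Longrightarrow>
           (\<lambda>k. a k * (LINT x|M. e k x * V x)) sums (LINT x|M. W x * V x)"
proof -
  let ?S = "\<lambda>n x. \<Sum>k<n. a k * e k x"
  let ?b = "\<lambda>n. v * ((\<Sum>k. (a k)\<^sup>2) - (\<Sum>k<n. (a k)\<^sup>2))"
  have v: "0 \<le> v"
  proof -
    have "v = (LINT x|M. (e 0 x)\<^sup>2)" using orth[of 0 0] by (simp add: power2_eq_square)
    then show ?thesis by simp
  qed
  have ee: "integrable M (\<lambda>x. e j x * e k x)" for j k
    by (intro integrable_mult_of_square_integrable em e2)
  have S2: "integrable M (\<lambda>x. (?S n x)\<^sup>2)" for n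
    using e2 by (intro integrable_square_sum) (auto simp: power_mult_distrib)
  have lim: "AE x in M. (\<lambda>n. ?S n x) \<longlonglongrightarrow> W x"
    using W by (simp add: sums_def)
  have "(LINT x|M. (?S m x - ?S n x)\<^sup>2) \<le> ?b n" if "n \<le> m" for m n
  proof -
    have d: "(\<Sum>k<m. f k) - (\<Sum>k<n. f k) = (\<Sum>k\<in>{n..<m}. f k)" for f :: "nat \<Rightarrow> real"
      using that sum_diff_nat_ivl[of 0 n m f] by (simp add: atLeast0LessThan)
    have "(LINT x|M. (?S m x - ?S n x)\<^sup>2)
        = (LINT x|M. (\<Sum>j\<in>{n..<m}. (\<Sum>k\<in>{n..<m}. a j * a k * (e j x * e k x))))"
      unfolding d power2_eq_square sum_product by (simp add: mult_ac)
    also have "\<dots> = (\<Sum>j\<in>{n..<m}. \<Sum>k\<in>{n..<m}. a j * a k * (if j = k then v else 0))"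
      using ee by (simp add: orth)
    also have "\<dots> = v * (\<Sum>j\<in>{n..<m}. (a j)\<^sup>2)"
      by (simp add: if_distrib sum.delta power2_eq_square sum_distrib_left mult_ac cong: if_cong)
    also have "\<dots> \<le> ?b n"
      unfolding d[symmetric] using v sum_le_suminf[OF a, of "{..<m}"] by (intro mult_left_mono) auto
    finally show ?thesis .
  qed
  moreover have "?b \<longlonglongrightarrow> v * ((\<Sum>k. (a k)\<^sup>2) - (\<Sum>k. (a k)\<^sup>2))"
    by (intro tendsto_intros summable_LIMSEQ a)
  ultimately have *: "integrable M (\<lambda>x. (W x)\<^sup>2)"
    "V \<in> borel_measurable M \<Longrightarrow> integrable M (\<lambda>x. (V x)\<^sup>2) \<Longrightarrow>
           (\<lambda>n. LINT x|M. ?S n x * V x) \<longlonglongrightarrow> (LINT x|M. W x * V x)" for V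
    using AE_limit_square_integrable[of ?S M W ?b] S2 lim by simp_all
  from *(1) show "integrable M (\<lambda>x. (W x)\<^sup>2)" .
  assume V: "V \<in> borel_measurable M" "integrable M (\<lambda>x. (V x)\<^sup>2)"
  have "(LINT x|M. ?S n x * V x) = (\<Sum>k<n. a k * (LINT x|M. e k x * V x))" for n
    using integrable_mult_of_square_integrable[OF em V(1) e2 V(2)]
    by (simp add: sum_distrib_right mult.assoc)
  with *(2)[OF V] show "(\<lambda>k. a k * (LINT x|M. e k x * V x)) sums (LINT x|M. W x * V x)"
    by (simp add: sums_def)
qed

section \<open>Spectral densities from centred representatives\<close>

text \<open>The processes of interest equal a centred process \<open>A\<close> plus a constant only almost surely. Means and
  covariances do not see the difference, so stationarity and the spectral representation reduce to the
  second moments \<open>r\<close> of \<open>A\<close>.\<close>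

lemma has_spectral_densityI:
  assumes M: "prob_space M"
    and Ym [measurable]: "\<And>t. Y t \<in> borel_measurable M" and Am [measurable]: "\<And>t. A t \<in> borel_measurable M"
    and YA: "\<And>t. AE x in M. Y t x = A t x + c"
    and A2: "\<And>t. integrable M (\<lambda>x. (A t x)\<^sup>2)" and A0: "\<And>t. (LINT x|M. A t x) = 0"
    and r: "\<And>t h. (LINT x|M. A (t + h) x * A t x) = r h"
    and f: "integrable circle_measure f" "\<And>l. 0 \<le> f l" "\<And>l. f (- l) = f l"
    and fourier: "\<And>h. (LINT l|circle_measure. of_real (f l) * cis (of_int h * l)) = complex_of_real (r h)"
  shows "has_spectral_density M Y f"
proof -
  interpret prob_space M by (rule M)
  have A1: "integrable M (A t)" for t
    using square_integrable_imp_integrable[OF Am A2] .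
  have Y1: "integrable M (Y t)" for t
  proof -
    have "integrable M (\<lambda>x. A t x + c)" using A1 by simp
    then show ?thesis using YA[of t] by (subst integrable_cong_AE[where g="\<lambda>x. A t x + c"]) auto
  qed
  have Y2: "integrable M (\<lambda>x. (Y t x)\<^sup>2)" for t
  proof -
    have "integrable M (\<lambda>x. (A t x + c)\<^sup>2)" by (intro integrable_square_add A2) auto
    moreover have "AE x in M. (Y t x)\<^sup>2 = (A t x + c)\<^sup>2" using YA[of t] by eventually_elim simp
    ultimately show ?thesis by (subst integrable_cong_AE[where g="\<lambda>x. (A t x + c)\<^sup>2"]) auto
  qed
  have mean: "(LINT x|M. Y t x) = c" for t
  proof -
    have "(LINT x|M. Y t x) = (LINT x|M. A t x + c)"
      using YA[of t] by (intro integral_cong_AE) auto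
    then show ?thesis using A1 A0 by (simp add: prob_space)
  qed
  have c: "cov M (Y (t + h)) (Y t) = r h" for t h
  proof -
    have "cov M (Y (t + h)) (Y t) = (LINT x|M. A (t + h) x * A t x)"
      unfolding cov_def mean
    proof (rule integral_cong_AE)
      show "AE x in M. (Y (t + h) x - c) * (Y t x - c) = A (t + h) x * A t x"
        using YA[of t] YA[of "t + h"] by eventually_elim simp
    qed measurable
    then show ?thesis using r by simp
  qed
  have "weakly_stationary M Y"
    unfolding weakly_stationary_def finite_variance_def
    using Y1 Y2 mean c c[of 0] by simp
  moreover have "set_integrable lborel {-pi<..pi} f"
    using f by (simp add: integrable_circle_iff)
  moreover have "complex_of_real (autocov M Y h)
      = (LINT l:{-pi<..pi}|lborel. exp (\<i> * of_int h * of_real l) * of_real (f l))" for h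
    using fourier[of h] c[of 0 h]
    by (simp add: autocov_def integral_circle_eq cis_conv_exp mult_ac)
  ultimately show ?thesis
    unfolding has_spectral_density_def using f by auto
qed

section \<open>Covariances of the log-volatility\<close>

context sfiegarch
begin

lemma Z_measurable [measurable]: "Z t \<in> borel_measurable M"
  using Z_finite_variance[of t] by (auto simp: finite_variance_def)

lemma Z_pair_indep:
  assumes "t \<noteq> u"
  shows "indep_var borel (Z t) borel (Z u)"
  using indep_vars_sum[of "{u}" t Z] indep_vars_subset[OF Z_indep, of "{t, u}"] assms by simp

lemma Z_identically_distributed:
  fixes \<phi> :: "real \<Rightarrow> real"
  assumes [measurable]: "\<phi> \<in> borel_measurable borel"
  shows "expectation (\<lambda>x. \<phi> (Z t x)) = expectation (\<lambda>x. \<phi> (Z 0 x))"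
    and "integrable M (\<lambda>x. \<phi> (Z t x)) \<longleftrightarrow> integrable M (\<lambda>x. \<phi> (Z 0 x))"
proof -
  show "expectation (\<lambda>x. \<phi> (Z t x)) = expectation (\<lambda>x. \<phi> (Z 0 x))"
    using integral_distr[of "Z t" M borel \<phi>] integral_distr[of "Z 0" M borel \<phi>] Z_ident[of t] by simp
  show "integrable M (\<lambda>x. \<phi> (Z t x)) \<longleftrightarrow> integrable M (\<lambda>x. \<phi> (Z 0 x))"
    using integrable_distr_eq[of "Z t" M borel \<phi>] integrable_distr_eq[of "Z 0" M borel \<phi>] Z_ident[of t] by simp
qed

text \<open>At distinct times independence factorizes the expectation, and one vanishing mean suffices to kill it.\<close>

lemma expectation_Z_product:
  fixes \<phi> \<psi> :: "real \<Rightarrow> real"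
  assumes m [measurable]: "\<phi> \<in> borel_measurable borel" "\<psi> \<in> borel_measurable borel"
    and i: "integrable M (\<lambda>x. \<phi> (Z 0 x))" "integrable M (\<lambda>x. \<psi> (Z 0 x))"
    and mean: "expectation (\<lambda>x. \<phi> (Z 0 x)) = 0"
  shows "expectation (\<lambda>x. \<phi> (Z t x) * \<psi> (Z u x))
    = (if t = u then expectation (\<lambda>x. \<phi> (Z 0 x) * \<psi> (Z 0 x)) else 0)"
proof (cases "t = u")
  case True
  then show ?thesis
    using Z_identically_distributed(1)[of "\<lambda>z. \<phi> z * \<psi> z"] by simp
next
  case False
  have "indep_var borel (\<phi> \<circ> Z t) borel (\<psi> \<circ> Z u)"
    by (rule indep_var_compose[OF Z_pair_indep[OF False] m])
  moreover have "integrable M (\<phi> \<circ> Z t)" "integrable M (\<psi> \<circ> Z u)"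
    using i Z_identically_distributed(2)[OF m(1)] Z_identically_distributed(2)[OF m(2)] by (simp_all add: comp_def)
  ultimately have "expectation (\<lambda>x. (\<phi> \<circ> Z t) x * (\<psi> \<circ> Z u) x) = expectation (\<phi> \<circ> Z t) * expectation (\<psi> \<circ> Z u)"
    by (rule indep_var_lebesgue_integral)
  then show ?thesis
    using False mean Z_identically_distributed(1)[OF m(1)] by (simp add: comp_def)
qed

text \<open>The function \<open>g\<close> as a map on the reals. The centring uses \<open>E |Z\<^sub>0|\<close> for every time; this agrees
  with \<open>gfun\<close> because the \<open>Z\<^sub>t\<close> are identically distributed.\<close>

definition news :: "real \<Rightarrow> real" where
  "news z = \<theta> * z + \<gamma> * (\<bar>z\<bar> - expectation (\<lambda>x. \<bar>Z 0 x\<bar>))"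

lemma news_measurable [measurable]: "news \<in> borel_measurable borel"
  unfolding news_def[abs_def] by measurable

lemma gfun_eq_news: "gfun M \<theta> \<gamma> (Z t) = (\<lambda>x. news (Z t x))"
  using Z_identically_distributed(1)[of abs t] by (simp add: gfun_def news_def fun_eq_iff)

lemma integrable_news: "integrable M (\<lambda>x. news (Z t x))"
  using Z_finite_variance[of t] unfolding news_def by (simp add: finite_variance_def)

lemma integrable_news_square: "integrable M (\<lambda>x. (news (Z t x))\<^sup>2)"
proof -
  have "integrable M (\<lambda>x. (\<theta> * Z t x + (\<gamma> * \<bar>Z t x\<bar> + - \<gamma> * expectation (\<lambda>x. \<bar>Z 0 x\<bar>)))\<^sup>2)"
    using Z_finite_variance[of t]
    by (intro integrable_square_add) (auto simp: finite_variance_def power_mult_distrib)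
  then show ?thesis by (simp add: news_def algebra_simps)
qed

lemma expectation_news: "expectation (\<lambda>x. news (Z t x)) = 0"
proof -
  have "integrable M (Z 0)" using Z_finite_variance[of 0] by (simp add: finite_variance_def)
  then have "expectation (\<lambda>x. news (Z 0 x)) = 0"
    using Z_mean[of 0] by (simp add: news_def prob_space)
  then show ?thesis using Z_identically_distributed(1)[of news t] by simp
qed

definition news_var :: real where "news_var = expectation (\<lambda>x. (news (Z 0 x))\<^sup>2)"

lemma expectation_news_product:
  "expectation (\<lambda>x. news (Z t x) * news (Z u x)) = (if t = u then news_var else 0)"
  using expectation_Z_product[of news news t u] integrable_news expectation_news
  by (simp add: news_var_def power2_eq_square)

definition log_vol :: "int \<Rightarrow> 'a \<Rightarrow> real" where
  "log_vol t x = ln ((\<sigma> t x)\<^sup>2) - \<omega>"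

lemma log_vol_measurable [measurable]: "log_vol t \<in> borel_measurable M"
  using sigma_rv[of t] unfolding log_vol_def[abs_def] by measurable

lemma log_vol_series: "AE x in M. (\<lambda>k. lam k * news (Z (t - 1 - int k) x)) sums log_vol t x"
  using sigma_eq[of t] by eventually_elim (simp add: gfun_eq_news log_vol_def)

context
  assumes lam_square_summable: "summable (\<lambda>k. (lam k)\<^sup>2)"
begin

text \<open>The moving average is an orthogonal series in the noise \<open>g(Z\<^bsub>t-1-k\<^esub>)\<close>, so it may be paired term by
  term with any square integrable variable.\<close>

lemma integrable_log_vol_square: "integrable M (\<lambda>x. (log_vol t x)\<^sup>2)"
  and log_vol_inner_product:
    "V \<in> borel_measurable M \<Longrightarrow> integrable M (\<lambda>x. (V x)\<^sup>2) \<Longrightarrow>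
      (\<lambda>k. lam k * expectation (\<lambda>x. news (Z (t - 1 - int k) x) * V x)) sums expectation (\<lambda>x. log_vol t x * V x)"
proof -
  note os = orthogonal_series[where e="\<lambda>k x. news (Z (t - 1 - int k) x)" and M=M and v=news_var and a=lam and W="log_vol t"]
  show "integrable M (\<lambda>x. (log_vol t x)\<^sup>2)"
    by (rule os(1)) (auto simp: integrable_news_square expectation_news_product lam_square_summable log_vol_series)
  show "V \<in> borel_measurable M \<Longrightarrow> integrable M (\<lambda>x. (V x)\<^sup>2) \<Longrightarrow>
      (\<lambda>k. lam k * expectation (\<lambda>x. news (Z (t - 1 - int k) x) * V x)) sums expectation (\<lambda>x. log_vol t x * V x)"
    by (rule os(2)) (auto simp: integrable_news_square expectation_news_product lam_square_summable log_vol_series)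
qed

lemma expectation_log_vol: "expectation (\<lambda>x. log_vol t x) = 0"
  using log_vol_inner_product[of "\<lambda>_. 1" t] expectation_news by (simp add: sums_iff)

text \<open>Of all the noise terms in \<open>V\<^sub>t\<close>, only the one at time \<open>u\<close> correlates with a function of \<open>Z\<^sub>u\<close>;
  its coefficient has index \<open>t - 1 - u\<close>, if that is nonnegative.\<close>

lemma expectation_log_vol_noise:
  assumes [measurable]: "\<psi> \<in> borel_measurable borel" and \<psi>: "integrable M (\<lambda>x. (\<psi> (Z 0 x))\<^sup>2)"
  shows "expectation (\<lambda>x. log_vol t x * \<psi> (Z u x))
    = expectation (\<lambda>x. news (Z 0 x) * \<psi> (Z 0 x)) * zero_ext lam (t - 1 - u)"
proof -
  let ?c = "expectation (\<lambda>x. news (Z 0 x) * \<psi> (Z 0 x))"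
  let ?K = "if t - 1 - u \<ge> 0 then {nat (t - 1 - u)} else {}"
  have \<psi>1: "integrable M (\<lambda>x. \<psi> (Z 0 x))"
    using \<psi> by (rule square_integrable_imp_integrable[rotated]) measurable
  have "integrable M (\<lambda>x. (\<psi> (Z u x))\<^sup>2)"
    using \<psi> Z_identically_distributed(2)[of "\<lambda>z. (\<psi> z)\<^sup>2" u] by simp
  then have "(\<lambda>k. lam k * expectation (\<lambda>x. news (Z (t - 1 - int k) x) * \<psi> (Z u x))) sums expectation (\<lambda>x. log_vol t x * \<psi> (Z u x))"
    by (intro log_vol_inner_product) measurable
  then have 1: "(\<lambda>k. lam k * (if t - 1 - int k = u then ?c else 0)) sums expectation (\<lambda>x. log_vol t x * \<psi> (Z u x))"
    using expectation_Z_product[of news \<psi>] integrable_news \<psi>1 expectation_news by simp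
  have 2: "(\<lambda>k. lam k * (if t - 1 - int k = u then ?c else 0)) sums (\<Sum>k\<in>?K. lam k * (if t - 1 - int k = u then ?c else 0))"
    by (rule sums_finite) auto
  show ?thesis
    using sums_unique2[OF 1 2] by (auto simp: zero_ext_def)
qed

text \<open>Expanding only \<open>V\<^bsub>t+h\<^esub>\<close> leaves covariances of \<open>V\<^sub>t\<close> with single noise terms, which are
  \<open>news_var\<close> times coefficients of the filter.\<close>

lemma expectation_log_vol_product:
  "expectation (\<lambda>x. log_vol (t + h) x * log_vol t x) = news_var * (\<Sum>k. lam k * zero_ext lam (int k - h))"
proof -
  have "expectation (\<lambda>x. news (Z (t + h - 1 - int k) x) * log_vol t x) = news_var * zero_ext lam (int k - h)" for k
    using expectation_log_vol_noise[of news t "t + h - 1 - int k"] integrable_news_square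
    by (simp add: news_var_def power2_eq_square mult.commute algebra_simps)
  then have s: "(\<lambda>k. lam k * (news_var * zero_ext lam (int k - h))) sums expectation (\<lambda>x. log_vol (t + h) x * log_vol t x)"
    using log_vol_inner_product[OF log_vol_measurable integrable_log_vol_square, of "t + h" t] by simp
  show ?thesis
  proof (cases "news_var = 0")
    case True
    then show ?thesis using s by (simp add: sums_iff)
  next
    case False
    have "(\<lambda>k. inverse news_var * (lam k * (news_var * zero_ext lam (int k - h))))
        sums (inverse news_var * expectation (\<lambda>x. log_vol (t + h) x * log_vol t x))"
      using s by (rule sums_mult)
    then show ?thesis using False by (simp add: sums_iff field_simps)
  qed
qed

end

end

section \<open>The spectral density of the log-squared process\<close>

theorem theorem3p1:
  fixes M :: "'a measure"
    and p q s :: nat and d :: real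
    and \<alpha> \<beta> :: "real poly" and \<theta> \<gamma> \<omega> :: real
    and lam :: "nat \<Rightarrow> real"
    and Z \<sigma> X :: "int \<Rightarrow> 'a \<Rightarrow> real"
  assumes process: "sfiegarch M p d q s \<alpha> \<beta> \<theta> \<gamma> \<omega> lam Z \<sigma> X"
    and d_less: "d < 1/2"
    and nontrivial: "\<not> (\<gamma> = 0 \<and> \<theta> = 0)"
    and alpha_nonzero: "\<And>z. norm z \<le> 1 \<Longrightarrow> cpoly \<alpha> z \<noteq> 0"
    and var_ln_Z: "\<And>t. finite_variance_ln M (\<lambda>x. (Z t x)\<^sup>2)"
  shows "\<exists>f_lnX f_ln\<sigma> f_lnZ.
     has_spectral_density M (\<lambda>t x. ln ((X t x)\<^sup>2)) f_lnX \<and>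
     has_spectral_density M (\<lambda>t x. ln ((\<sigma> t x)\<^sup>2)) f_ln\<sigma> \<and>
     has_spectral_density M (\<lambda>t x. ln ((Z t x)\<^sup>2)) f_lnZ \<and>
     (\<forall>l\<in>{0..pi}.
        f_lnX l = f_ln\<sigma> l
                  + cov M (gfun M \<theta> \<gamma> (Z 0)) (\<lambda>x. ln ((Z 0 x)\<^sup>2)) / pi
                    * Re (exp (- \<i> * of_real l) * Lambda \<alpha> \<beta> s d l)
                  + f_lnZ l \<and>
        f_ln\<sigma> l = prob_space.variance M (gfun M \<theta> \<gamma> (Z 0)) / (2 * pi)
                  * ((norm (cpoly \<alpha> (exp (- \<i> * of_real l))))\<^sup>2
                     / (norm (cpoly \<beta> (exp (- \<i> * of_real l))))\<^sup>2)
                  * gpow (norm (1 - exp (- \<i> * of_nat s * of_real l))) (- 2 * d) \<and>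
        (\<forall>t. f_lnZ l = prob_space.variance M (\<lambda>x. ln ((Z t x)\<^sup>2)) / (2 * pi)))"
proof -
  interpret sfiegarch M p d q s \<alpha> \<beta> \<theta> \<gamma> \<omega> lam Z \<sigma> X by (rule process)
  obtain D where "hardy_boundary lam (sfie_filter \<alpha> \<beta> s d) (Lambda \<alpha> \<beta> s d) D"
    using sfie_hardy_boundary[OF s_pos d_less beta_nonzero lam_series] by blast
  then interpret hardy_boundary lam "sfie_filter \<alpha> \<beta> s d" "Lambda \<alpha> \<beta> s d" D .
  note lam2 = summable_coefficients_square
  note [measurable] = X_rv sigma_rv
  let ?\<Lambda> = "Lambda \<alpha> \<beta> s d"

  \<comment> \<open>\<open>\<psi>(Z\<^sub>t)\<close> is \<open>ln (Z\<^sub>t\<^sup>2)\<close> centred; \<open>C\<close> and \<open>vL\<close> are \<open>C\<^sub>1\<close> and the variance of \<open>ln (Z\<^sub>t\<^sup>2)\<close>.\<close>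
  define \<mu> where "\<mu> = expectation (\<lambda>x. ln ((Z 0 x)\<^sup>2))"
  define \<psi> where "\<psi> z = ln (z\<^sup>2) - \<mu>" for z
  define vL where "vL = expectation (\<lambda>x. (\<psi> (Z 0 x))\<^sup>2)"
  define C where "C = expectation (\<lambda>x. news (Z 0 x) * \<psi> (Z 0 x))"
  have \<psi>m [measurable]: "\<psi> \<in> borel_measurable borel"
    unfolding \<psi>_def[abs_def] by measurable
  have lnZ: "integrable M (\<lambda>x. ln ((Z t x)\<^sup>2))" "integrable M (\<lambda>x. (ln ((Z t x)\<^sup>2))\<^sup>2)" for t
    using var_ln_Z[of t] by (auto simp: finite_variance_ln_def finite_variance_def)
  have \<psi>1: "integrable M (\<lambda>x. \<psi> (Z t x))" for t
    using lnZ unfolding \<psi>_def by simp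
  have \<psi>2: "integrable M (\<lambda>x. (\<psi> (Z t x))\<^sup>2)" for t
    using integrable_square_add[of "\<lambda>x. ln ((Z t x)\<^sup>2)" M "\<lambda>_. - \<mu>"] lnZ unfolding \<psi>_def by simp
  have \<psi>0: "expectation (\<lambda>x. \<psi> (Z t x)) = 0" for t
    using lnZ Z_identically_distributed(1)[of \<psi> t] by (simp add: \<psi>_def \<mu>_def prob_space)
  have \<psi>\<psi>: "expectation (\<lambda>x. \<psi> (Z t x) * \<psi> (Z u x)) = (if t = u then vL else 0)" for t u
    using expectation_Z_product[of \<psi> \<psi> t u] \<psi>1 \<psi>0 by (simp add: vL_def power2_eq_square)

  define f\<sigma> where "f\<sigma> l = news_var / (2 * pi) * (norm (?\<Lambda> l))\<^sup>2" for l
  define fZ where "fZ l = vL / (2 * pi)" for l :: real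
  define fX where "fX l = f\<sigma> l + C / pi * Re (cis (- l) * ?\<Lambda> l) + fZ l" for l
  let ?r\<sigma> = "\<lambda>h. news_var * (\<Sum>k. lam k * zero_ext lam (int k - h))"
  let ?rZ = "\<lambda>h::int. if h = 0 then vL else 0"
  let ?rX = "\<lambda>h. ?r\<sigma> h + C * (zero_ext lam (h - 1) + zero_ext lam (- h - 1)) + ?rZ h"

  have i\<sigma>: "integrable circle_measure f\<sigma>"
    unfolding f\<sigma>_def by (intro integrable_mult_right integrable_norm_B_square)
  have iZ: "integrable circle_measure fZ"
    unfolding fZ_def by simp
  have icross: "integrable circle_measure (\<lambda>l. cis (of_int m * l) * ?\<Lambda> l)" for m
  proof (rule Bochner_Integration.integrable_bound[OF integrable_B])
    show "(\<lambda>l. cis (of_int m * l) * ?\<Lambda> l) \<in> borel_measurable circle_measure" by measurable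
  qed (simp add: norm_mult)
  have iX: "integrable circle_measure fX"
    unfolding fX_def using icross[of "-1"]
    by (intro Bochner_Integration.integrable_add i\<sigma> iZ integrable_mult_right integrable_Re) simp

  have F\<sigma>: "(LINT l|circle_measure. of_real (f\<sigma> l) * cis (of_int h * l)) = complex_of_real (?r\<sigma> h)" for h
  proof -
    have "(LINT l|circle_measure. of_real (f\<sigma> l) * cis (of_int h * l))
        = of_real (news_var / (2 * pi)) * (LINT l|circle_measure. of_real ((norm (?\<Lambda> l))\<^sup>2) * cis (of_int h * l))"
      unfolding f\<sigma>_def of_real_mult mult.assoc by (rule integral_mult_right_zero)
    then show ?thesis unfolding fourier_coefficient_norm_B_square by simp
  qed
  have FZ: "(LINT l|circle_measure. of_real (fZ l) * cis (of_int h * l)) = complex_of_real (?rZ h)" for h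
    using integral_cis[of h] by (simp add: fZ_def)
  have FC: "(LINT l|circle_measure. of_real (C / pi * Re (cis (- l) * ?\<Lambda> l)) * cis (of_int h * l))
      = complex_of_real (C * (zero_ext lam (h - 1) + zero_ext lam (- h - 1)))" for h
  proof -
    \<comment> \<open>Writing the real part as half a sum of conjugates turns the cross term into the Fourier
    coefficients of \<open>\<Lambda>\<close> of index \<open>h - 1\<close> and \<open>- h - 1\<close>; at most one of them is nonzero.\<close>
    have "of_real (C / pi * Re (cis (- l) * ?\<Lambda> l)) * cis (of_int h * l)
        = of_real (C / (2 * pi)) * (?\<Lambda> l * cis (of_int (h - 1) * l) + cnj (?\<Lambda> l * cis (of_int (- h - 1) * l)))" for l
    proof -
      have "complex_of_real (2 * Re (cis (- l) * ?\<Lambda> l)) = cis (- l) * ?\<Lambda> l + cnj (cis (- l) * ?\<Lambda> l)"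
        by (rule complex_add_cnj[symmetric])
      then have "complex_of_real (2 * Re (cis (- l) * ?\<Lambda> l)) * cis (of_int h * l)
          = ?\<Lambda> l * (cis (- l) * cis (of_int h * l)) + cnj (?\<Lambda> l) * (cis l * cis (of_int h * l))"
        by (simp only: complex_cnj_mult cis_cnj minus_minus) (simp add: algebra_simps)
      also have "\<dots> = ?\<Lambda> l * cis (of_int (h - 1) * l) + cnj (?\<Lambda> l * cis (of_int (- h - 1) * l))"
        by (simp add: cis_mult cis_cnj algebra_simps)
      finally have "of_real (C / (2 * pi)) * (complex_of_real (2 * Re (cis (- l) * ?\<Lambda> l)) * cis (of_int h * l))
        = of_real (C / (2 * pi)) * (?\<Lambda> l * cis (of_int (h - 1) * l) + cnj (?\<Lambda> l * cis (of_int (- h - 1) * l)))"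
        by (rule arg_cong)
      moreover have "complex_of_real (C / pi * x) * e = of_real (C / (2 * pi)) * (of_real (2 * x) * e)" for x e
        by simp
      ultimately show ?thesis by metis
    qed
    then have E: "(LINT l|circle_measure. of_real (C / pi * Re (cis (- l) * ?\<Lambda> l)) * cis (of_int h * l))
      = of_real (C / (2 * pi)) * ((LINT l|circle_measure. ?\<Lambda> l * cis (of_int (h - 1) * l)) + cnj (LINT l|circle_measure. ?\<Lambda> l * cis (of_int (- h - 1) * l)))"
      using icross[of "h - 1"] icross[of "- h - 1"]
      by (simp only: integral_mult_right_zero Bochner_Integration.integral_add complex_integrable_cnj
          Bochner_Integration.integral_cnj mult.commute[of "cis _"])
    show ?thesis
      unfolding E fourier_coefficient_B by (simp add: field_simps)
  qed
  have FX: "(LINT l|circle_measure. of_real (fX l) * cis (of_int h * l)) = complex_of_real (?rX h)" for h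
  proof -
    have m: "integrable circle_measure (\<lambda>l. of_real (f l) * cis (of_int h * l))" if "integrable circle_measure f" for f :: "real \<Rightarrow> real"
    proof (rule Bochner_Integration.integrable_bound[OF that])
      note [measurable] = borel_measurable_integrable[OF that]
      show "(\<lambda>l. of_real (f l) * cis (of_int h * l)) \<in> borel_measurable circle_measure" by measurable
    qed (simp add: norm_mult)
    have iC: "integrable circle_measure (\<lambda>l. C / pi * Re (cis (- l) * ?\<Lambda> l))"
      using icross[of "-1"] by (intro integrable_mult_right integrable_Re) simp
    show ?thesis
      unfolding fX_def of_real_add distrib_right
      by (simp only: Bochner_Integration.integral_add Bochner_Integration.integrable_add m i\<sigma> iZ iC F\<sigma> FZ FC)
  qed

  have nv: "0 \<le> news_var" by (simp add: news_var_def)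
  have vL: "0 \<le> vL" by (simp add: vL_def)
  have fX_nonneg: "0 \<le> fX l" for l
  proof -
    let ?w = "cis (- l) * ?\<Lambda> l"
    have gp: "integrable M (\<lambda>x. news (Z 0 x) * \<psi> (Z 0 x))"
      by (intro integrable_mult_of_square_integrable integrable_news_square \<psi>2) measurable
    \<comment> \<open>The variance of \<open>Re ?w * g(Z\<^sub>0) + ln (Z\<^sub>0\<^sup>2)\<close> is a quadratic in \<open>Re ?w\<close>; replacing \<open>(Re ?w)\<^sup>2\<close>
    by \<open>|\<Lambda>(l)|\<^sup>2\<close> only increases it.\<close>
    have "0 \<le> expectation (\<lambda>x. (Re ?w * news (Z 0 x) + \<psi> (Z 0 x))\<^sup>2)" by simp
    also have "(\<lambda>x. (Re ?w * news (Z 0 x) + \<psi> (Z 0 x))\<^sup>2)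
      = (\<lambda>x. (Re ?w)\<^sup>2 * (news (Z 0 x))\<^sup>2 + 2 * Re ?w * (news (Z 0 x) * \<psi> (Z 0 x)) + (\<psi> (Z 0 x))\<^sup>2)"
      by (simp only: power2_sum power_mult_distrib mult.assoc) (simp add: add_ac)
    also have "expectation \<dots> = (Re ?w)\<^sup>2 * news_var + 2 * Re ?w * C + vL"
      using gp integrable_news_square[of 0] \<psi>2[of 0] unfolding news_var_def C_def vL_def by simp
    also have "(Re ?w)\<^sup>2 * news_var \<le> (norm (?\<Lambda> l))\<^sup>2 * news_var"
    proof (rule mult_right_mono[OF _ nv])
      have "\<bar>Re ?w\<bar> \<le> norm (?\<Lambda> l)" using abs_Re_le_cmod[of ?w] by (simp add: norm_mult)
      then show "(Re ?w)\<^sup>2 \<le> (norm (?\<Lambda> l))\<^sup>2" by (metis abs_le_square_iff abs_norm_cancel)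
    qed
    finally have "0 \<le> ((norm (?\<Lambda> l))\<^sup>2 * news_var + 2 * Re ?w * C + vL) / (2 * pi)" by simp
    also have "\<dots> = fX l"
      unfolding fX_def f\<sigma>_def fZ_def by (simp add: field_simps)
    finally show ?thesis .
  qed
  have f\<sigma>_even: "f\<sigma> (- l) = f\<sigma> l" for l
    by (simp add: f\<sigma>_def Lambda_minus)
  have fX_even: "fX (- l) = fX l" for l
  proof -
    have "cis (- (- l)) * ?\<Lambda> (- l) = cnj (cis (- l) * ?\<Lambda> l)"
      unfolding Lambda_minus by (simp add: cis_cnj)
    then show ?thesis unfolding fX_def f\<sigma>_even fZ_def by (simp only: complex_cnj)  simp
  qed

  have lnX: "AE x in M. ln ((X t x)\<^sup>2) = (log_vol t x + \<psi> (Z t x)) + (\<omega> + \<mu>)" for t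
  proof -
    have "AE x in M. (Z t x)\<^sup>2 > 0" using var_ln_Z[of t] by (simp add: finite_variance_ln_def)
    \<comment> \<open>Both factors are almost surely nonzero, so the logarithm of the product splits.\<close>
    with X_eq[of t] sigma_eq[of t] show ?thesis
      by eventually_elim (auto simp: log_vol_def \<psi>_def power_mult_distrib ln_mult)
  qed
  note V2 = integrable_log_vol_square[OF lam2]
  have V1: "integrable M (log_vol t)" for t
    by (rule square_integrable_imp_integrable[OF log_vol_measurable V2])
  have cX: "expectation (\<lambda>x. (log_vol (t + h) x + \<psi> (Z (t + h) x)) * (log_vol t x + \<psi> (Z t x))) = ?rX h" for t h
  proof -
    have idx: "t + h - 1 - t = h - 1" "t - 1 - (t + h) = - h - 1" by simp_all
    have i: "integrable M (\<lambda>x. log_vol u x * log_vol v x)" "integrable M (\<lambda>x. log_vol u x * \<psi> (Z v x))"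
      "integrable M (\<lambda>x. \<psi> (Z u x) * \<psi> (Z v x))" for u v
      by (intro integrable_mult_of_square_integrable V2 \<psi>2; measurable)+
    have "expectation (\<lambda>x. (log_vol (t + h) x + \<psi> (Z (t + h) x)) * (log_vol t x + \<psi> (Z t x)))
      = expectation (\<lambda>x. log_vol (t + h) x * log_vol t x + log_vol (t + h) x * \<psi> (Z t x)
          + log_vol t x * \<psi> (Z (t + h) x) + \<psi> (Z (t + h) x) * \<psi> (Z t x))"
      by (simp add: algebra_simps)
    also have "\<dots> = expectation (\<lambda>x. log_vol (t + h) x * log_vol t x) + expectation (\<lambda>x. log_vol (t + h) x * \<psi> (Z t x))
          + expectation (\<lambda>x. log_vol t x * \<psi> (Z (t + h) x)) + expectation (\<lambda>x. \<psi> (Z (t + h) x) * \<psi> (Z t x))"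
      by (simp only: Bochner_Integration.integral_add Bochner_Integration.integrable_add i)
    also have "\<dots> = ?rX h"
      unfolding expectation_log_vol_product[OF lam2] expectation_log_vol_noise[OF lam2 \<psi>m \<psi>2] \<psi>\<psi> C_def[symmetric] idx
      by (simp add: distrib_left)
    finally show ?thesis .
  qed

  have "has_spectral_density M (\<lambda>t x. ln ((X t x)\<^sup>2)) fX"
  proof (rule has_spectral_densityI[where A="\<lambda>t x. log_vol t x + \<psi> (Z t x)" and c="\<omega> + \<mu>" and r="?rX"])
    show "integrable M (\<lambda>x. (log_vol t x + \<psi> (Z t x))\<^sup>2)" for t
      by (intro integrable_square_add V2 \<psi>2) measurable
    show "expectation (\<lambda>x. log_vol t x + \<psi> (Z t x)) = 0" for t
      using V1 \<psi>1 \<psi>0 expectation_log_vol[OF lam2] by simp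
    show "AE x in M. ln ((X t x)\<^sup>2) = (log_vol t x + \<psi> (Z t x)) + (\<omega> + \<mu>)" for t by (rule lnX)
    show "expectation (\<lambda>x. (log_vol (t + h) x + \<psi> (Z (t + h) x)) * (log_vol t x + \<psi> (Z t x))) = ?rX h" for t h
      by (rule cX)
    show "(LINT l|circle_measure. of_real (fX l) * cis (of_int h * l)) = complex_of_real (?rX h)" for h by (rule FX)
    show "prob_space M" by unfold_locales
    show "(\<lambda>x. ln ((X t x)\<^sup>2)) \<in> borel_measurable M" "(\<lambda>x. log_vol t x + \<psi> (Z t x)) \<in> borel_measurable M" for t
      by measurable
  qed (rule iX fX_nonneg fX_even)+
  moreover have "has_spectral_density M (\<lambda>t x. ln ((\<sigma> t x)\<^sup>2)) f\<sigma>"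
  proof (rule has_spectral_densityI[where A=log_vol and c="\<omega>" and r="?r\<sigma>"])
    show "AE x in M. ln ((\<sigma> t x)\<^sup>2) = log_vol t x + \<omega>" for t by (simp add: log_vol_def)
    show "expectation (\<lambda>x. log_vol (t + h) x * log_vol t x) = ?r\<sigma> h" for t h
      by (rule expectation_log_vol_product[OF lam2])
    show "(LINT l|circle_measure. of_real (f\<sigma> l) * cis (of_int h * l)) = complex_of_real (?r\<sigma> h)" for h by (rule F\<sigma>)
    show "prob_space M" by unfold_locales
    show "0 \<le> f\<sigma> l" for l using nv by (simp add: f\<sigma>_def)
    show "(\<lambda>x. ln ((\<sigma> t x)\<^sup>2)) \<in> borel_measurable M" for t
      by measurable
  qed (rule i\<sigma> f\<sigma>_even V2 expectation_log_vol[OF lam2] log_vol_measurable)+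
  moreover have "has_spectral_density M (\<lambda>t x. ln ((Z t x)\<^sup>2)) fZ"
  proof (rule has_spectral_densityI[where A="\<lambda>t x. \<psi> (Z t x)" and c="\<mu>" and r="?rZ"])
    show "AE x in M. ln ((Z t x)\<^sup>2) = \<psi> (Z t x) + \<mu>" for t by (simp add: \<psi>_def)
    show "expectation (\<lambda>x. \<psi> (Z (t + h) x) * \<psi> (Z t x)) = ?rZ h" for t h
      unfolding \<psi>\<psi> by simp
    show "(LINT l|circle_measure. of_real (fZ l) * cis (of_int h * l)) = complex_of_real (?rZ h)" for h by (rule FZ)
    show "prob_space M" by unfold_locales
    show "0 \<le> fZ l" "fZ (- l) = fZ l" for l using vL by (simp_all add: fZ_def)
    show "(\<lambda>x. ln ((Z t x)\<^sup>2)) \<in> borel_measurable M" "(\<lambda>x. \<psi> (Z t x)) \<in> borel_measurable M" for t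
      by measurable
  qed (rule iZ \<psi>2 \<psi>0)+
  moreover have "cov M (gfun M \<theta> \<gamma> (Z 0)) (\<lambda>x. ln ((Z 0 x)\<^sup>2)) = C"
    by (simp add: cov_def gfun_eq_news expectation_news C_def \<psi>_def \<mu>_def)
  moreover have "variance (gfun M \<theta> \<gamma> (Z 0)) = news_var"
    by (simp add: gfun_eq_news expectation_news news_var_def)
  moreover have "variance (\<lambda>x. ln ((Z t x)\<^sup>2)) = vL" for t
  proof -
    have "expectation (\<lambda>x. ln ((Z t x)\<^sup>2)) = \<mu>"
      unfolding \<mu>_def by (rule Z_identically_distributed(1)) measurable
    then have "variance (\<lambda>x. ln ((Z t x)\<^sup>2)) = expectation (\<lambda>x. (\<psi> (Z t x))\<^sup>2)"
      by (simp add: \<psi>_def)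
    also have "\<dots> = vL"
      unfolding vL_def by (rule Z_identically_distributed(1)) measurable
    finally show ?thesis .
  qed
  ultimately show ?thesis
    by (intro exI[of _ fX] exI[of _ f\<sigma>] exI[of _ fZ])
      (auto simp: fX_def f\<sigma>_def fZ_def norm_Lambda_square cis_conv_exp)
qed

end
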